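(* Let $S$ be a finite set of positive integers with largest element $k$, and suppose the smallest positive integer not in $S$ is $k-c$ for some integer $c>0$. Let $(a_n)_{n\ge1}$ be the $S$-LID sequence. Suppose there exists an integer $d>0$ such that: (i) $k\ge 2d-4c+2$; (ii) for every integer $n$ with $c+d+1\le n\le k+c+1+d$, $a_{n+1}+a_n > a_{n+c}+a_{n-d}$; (iii) for every integer $n$ with $k+c+1\le n\le 2k+c+d+2$, \[ a_n+a_{n-k} > \sum_{\substack{i\ge0\\ i(k-c)<n-1}} a_{n-1-i(k-c)}. \] Then $a_{n+1}=a_n+a_{n-k}$ for all integers $n>k+c$.
   Context: For a set $S$ of positive integers, the $S$-legal index difference ($S$-LID) sequence $(a_n)_{n\ge 1}$ is defined recursively: for each positive integer $n$, $a_n$ is the smallest positive integer that cannot be written as $\sum_{\ell\in L} a_\ell$ for some set $L \subseteq \{1,\dots,n-1\}$ such that $|i-j|\notin S$ for all $i,j\in L$ (the empty sum is $0$). *)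

theory Defs
  imports Main
begin

definition legal_index_set :: "nat set \<Rightarrow> nat set \<Rightarrow> bool" where
  "legal_index_set S L \<longleftrightarrow> (\<forall>i\<in>L. \<forall>j\<in>L. nat \<bar>int i - int j\<bar> \<notin> S)"

text \<open>Indices start at \<open>1\<close>; the value at index \<open>0\<close> is a dummy that no term of the sequence depends on.\<close>

function lid :: "nat set \<Rightarrow> nat \<Rightarrow> nat" where
  "lid S n = (LEAST m. m > 0 \<and>
     \<not> (\<exists>L\<in>Pow {1..<n}. legal_index_set S L \<and> m = (\<Sum>l\<in>L. lid S l)))"
  by pat_completeness auto
termination
  by (relation "measure snd") auto

declare lid.simps [simp del]

end

theory Submission
  imports Defs
begin

text \<open>
  Write \<open>a\<close> for the sequence, \<open>m = k - c\<close>, and \<open>T x = a x + a (x - m) + a (x - 2 * m) + \<dots>\<close>. Legal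
  index sets have gaps of at least \<open>m\<close>, so \<open>T x\<close> bounds every legal sum over \<open>{1..x}\<close>. Hence
  \<open>a (n + 1) = a n + a (n - k)\<close> as soon as \<open>T (n - 1) < a n + a (n - k)\<close>, and for \<open>n = N + k + 1\<close>
  the recurrence turns this inequality into \<open>F N > 0\<close> with \<open>F N = a N + a (N + 1) - T (N + c)\<close>.
  Condition (iii) is this positivity for small \<open>N\<close>; it has to be propagated to all \<open>N\<close>.

  The recurrence gives \<open>F (N + m) = F N + g (N + m)\<close> with \<open>g N = a N + a (N + 1) - a (N + c + 2)\<close>, and
  \<open>g\<close> satisfies the same recurrence as \<open>a\<close>. So it suffices that \<open>g\<close> is nonnegative on \<open>k + 1\<close>
  consecutive arguments. There \<open>g\<close> is a sum of initial values of \<open>g\<close>: these are explicit up to \<open>m - c\<close>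
  because \<open>a j = j\<close> for \<open>j \<le> m + 1\<close>, and the remaining ones are bounded below by (iii), since (ii) forces
  \<open>c \<le> d\<close>. Condition (iii) also yields \<open>8 * k \<ge> 3 * c\<^sup>2 + 21 * c - 10\<close>, which makes the explicit part
  dominate for \<open>c \<ge> 7\<close>. For \<open>c \<le> 6\<close> finitely many \<open>m\<close> are left; for each of them the claim is a problem
  of linear arithmetic in at most \<open>2 * c - 1\<close> unknown terms of the sequence.
\<close>

section \<open>Legal sums\<close>

text \<open>The sum in (iii) is \<open>stride_sum (k - c) (lid S) (n - 1)\<close>. The strict bound
  \<open>i * m < x\<close> keeps the arguments positive, so the dummy value at 0 never enters. The
  type is polymorphic because both the natural-valued sequence and its integer continuation are
  summed.\<close>

definition stride_sum :: "nat \<Rightarrow> (nat \<Rightarrow> 'a::comm_monoid_add) \<Rightarrow> nat \<Rightarrow> 'a" where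
  "stride_sum m f x = (\<Sum>i | i * m < x. f (x - i * m))"

lemma stride_sum_0 [simp]: "stride_sum m f 0 = 0"
  by (simp add: stride_sum_def)

lemma stride_sum_rec:
  assumes "0 < m" "0 < x"
  shows "stride_sum m f x = f x + stride_sum m f (x - m)"
proof -
  have fin: "finite {i. i * m < y}" for y
  proof (rule finite_subset)
    show "{i. i * m < y} \<subseteq> {..y}"
    proof
      fix i assume "i \<in> {i. i * m < y}"
      then have "i * m < y" by simp
      moreover have "i * 1 \<le> i * m" using \<open>0 < m\<close> by (intro mult_le_mono2) simp
      ultimately have "i \<le> y" by linarith
      then show "i \<in> {..y}" by simp
    qed
  qed simp
  have split: "{i. i * m < x} = insert 0 (Suc ` {i. i * m < x - m})"
  proof (intro set_eqI iffI)
    fix i assume "i \<in> {i. i * m < x}"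
    then show "i \<in> insert 0 (Suc ` {i. i * m < x - m})"
      by (cases i) auto
  qed (use \<open>0 < x\<close> in auto)
  have "stride_sum m f x = f x + (\<Sum>i \<in> Suc ` {i. i * m < x - m}. f (x - i * m))"
    unfolding stride_sum_def split by (subst sum.insert) (use fin in auto)
  also have "(\<Sum>i \<in> Suc ` {i. i * m < x - m}. f (x - i * m)) = stride_sum m f (x - m)"
    unfolding stride_sum_def by (subst sum.reindex) (auto simp: algebra_simps)
  finally show ?thesis .
qed

lemma stride_sum_short: "0 < m \<Longrightarrow> 0 < x \<Longrightarrow> x \<le> m \<Longrightarrow> stride_sum m f x = f x"
  by (simp add: stride_sum_rec)

lemma stride_sum_cong:
  assumes "\<And>y. 0 < y \<Longrightarrow> y \<le> x \<Longrightarrow> f y = g y"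
  shows "stride_sum m f x = stride_sum m g x"
  unfolding stride_sum_def by (rule sum.cong) (auto intro!: assms)

lemma int_stride_sum: "int (stride_sum m f x) = stride_sum m (\<lambda>i. int (f i)) x"
  by (simp add: stride_sum_def)

section \<open>Representable numbers, positivity and monotonicity of the sequence\<close>

definition representable :: "nat set \<Rightarrow> nat \<Rightarrow> nat \<Rightarrow> bool" where
  "representable S n v \<longleftrightarrow> (\<exists>L. L \<subseteq> {1..<n} \<and> legal_index_set S L \<and> v = (\<Sum>l\<in>L. lid S l))"

lemma lid_eq_Least: "lid S n = (LEAST v. 0 < v \<and> \<not> representable S n v)"
  by (subst lid.simps) (simp add: representable_def Bex_def Pow_def)

lemma exists_not_representable: "\<exists>v. 0 < v \<and> \<not> representable S n v"
proof (intro exI conjI)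
  let ?v = "Suc (\<Sum>l\<in>{1..<n}. lid S l)"
  show "\<not> representable S n ?v"
  proof
    assume "representable S n ?v"
    then obtain L where "L \<subseteq> {1..<n}" "?v = (\<Sum>l\<in>L. lid S l)"
      by (auto simp: representable_def)
    then show False
      using sum_mono2[of "{1..<n}" L "lid S"] by simp
  qed
qed simp

lemma lid_pos: "0 < lid S n" and lid_not_representable: "\<not> representable S n (lid S n)"
  using LeastI_ex[OF exists_not_representable[of S n]] by (simp_all add: lid_eq_Least)

lemma lid_le: "0 < v \<Longrightarrow> \<not> representable S n v \<Longrightarrow> lid S n \<le> v"
  by (subst lid_eq_Least) (rule Least_le, simp)

lemma representable_less_lid: "v < lid S n \<Longrightarrow> representable S n v"
proof (cases "v = 0")
  case True
  then show ?thesis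
    unfolding representable_def by (intro exI[of _ "{}"]) (simp add: legal_index_set_def)
next
  case False
  assume "v < lid S n"
  with False show ?thesis using lid_le[of v S n] by auto
qed

text \<open>Every lower bound on a term is proved through this: \<open>lid S n\<close> itself is not
  representable, so it cannot lie among the numbers below \<open>B\<close>.\<close>

lemma le_lid: "(\<And>v. v < B \<Longrightarrow> representable S n v) \<Longrightarrow> B \<le> lid S n"
  using lid_not_representable[of S n] not_le by blast

lemma representable_mono:
  assumes "representable S n v" "n \<le> n'"
  shows "representable S n' v"
proof -
  have "{1..<n} \<subseteq> {1..<n'}" using assms(2) by auto
  then show ?thesis using assms(1) unfolding representable_def by blast
qed

lemma representable_single:
  assumes "0 \<notin> S" "1 \<le> j" "j < n"
  shows "representable S n (lid S j)"
  unfolding representable_def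
  by (rule exI[of _ "{j}"]) (use assms in \<open>auto simp: legal_index_set_def\<close>)

lemma representable_pair:
  assumes "0 \<notin> S" "1 \<le> i" "i < j" "j < n" "j - i \<notin> S"
  shows "representable S n (lid S i + lid S j)"
proof -
  have "nat \<bar>int i - int j\<bar> = j - i" "nat \<bar>int j - int i\<bar> = j - i"
    using assms by auto
  then show ?thesis
    unfolding representable_def
    by (intro exI[of _ "{i, j}"]) (use assms in \<open>auto simp: legal_index_set_def\<close>)
qed

text \<open>Numbers below \<open>lid S n\<close> need only indices below \<open>n\<close>, and
  \<open>lid S n\<close> is represented by \<open>{n}\<close>, which is legal because 0 is not in
  \<open>S\<close>.\<close>

lemma lid_less_Suc:
  assumes "0 \<notin> S" "1 \<le> n"
  shows "lid S n < lid S (Suc n)"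
proof -
  have "Suc (lid S n) \<le> lid S (Suc n)"
  proof (rule le_lid)
    fix v assume "v < Suc (lid S n)"
    then consider "v < lid S n" | "v = lid S n" by linarith
    then show "representable S (Suc n) v"
      by cases (use assms representable_less_lid representable_mono[of S n v "Suc n"]
                  representable_single[of S n "Suc n"] in auto)
  qed
  then show ?thesis by simp
qed

lemma lid_less:
  assumes "0 \<notin> S" "1 \<le> i" "i < j"
  shows "lid S i < lid S j"
  using assms(3,2)
proof (induction rule: strict_inc_induct)
  case (base i)
  then show ?case using lid_less_Suc[OF assms(1)] by simp
next
  case (step i)
  then show ?case using lid_less_Suc[OF assms(1), of i] by force
qed

lemma lid_le_lid: "0 \<notin> S \<Longrightarrow> 1 \<le> i \<Longrightarrow> i \<le> j \<Longrightarrow> lid S i \<le> lid S j"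
  using lid_less[of S i j] by (cases "i = j") auto

lemma lid_ge_index:
  assumes "0 \<notin> S"
  shows "1 \<le> j \<Longrightarrow> j \<le> lid S j"
proof (induction j rule: nat_induct_at_least)
  case base
  then show ?case using lid_pos[of S 1] by simp
next
  case (Suc j)
  then show ?case using lid_less_Suc[OF assms, of j] by simp
qed

section \<open>Superadditivity, upper bounds for legal sums, and the recurrence criterion\<close>

lemma legal_subset: "legal_index_set S L \<Longrightarrow> L' \<subseteq> L \<Longrightarrow> legal_index_set S L'"
  by (auto simp: legal_index_set_def)

lemma legal_diff:
  assumes "legal_index_set S L" "i \<in> L" "j \<in> L" "i \<le> j"
  shows "j - i \<notin> S"
proof -
  have "nat \<bar>int j - int i\<bar> \<notin> S" using assms(1-3) unfolding legal_index_set_def by blast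
  moreover have "nat \<bar>int j - int i\<bar> = j - i" using assms(4) by auto
  ultimately show ?thesis by metis
qed

text \<open>A number \<open>v\<close> in the upper range is handled by representing
  \<open>v - lid S n\<close> with indices below \<open>n - k\<close> and adding \<open>n\<close>:
  every new difference exceeds \<open>k\<close>, hence avoids \<open>S\<close>.\<close>

lemma lid_superadditive:
  assumes "0 \<notin> S" "\<And>s. s \<in> S \<Longrightarrow> s \<le> k" "k < n"
  shows "lid S n + lid S (n - k) \<le> lid S (Suc n)"
proof (rule le_lid)
  fix v assume v: "v < lid S n + lid S (n - k)"
  show "representable S (Suc n) v"
  proof (cases "v < lid S n")
    case True
    then show ?thesis using representable_less_lid representable_mono[of S n v "Suc n"] by simp
  next
    case False
    then have "representable S (n - k) (v - lid S n)"
      using v by (intro representable_less_lid) simp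
    then obtain L where L: "L \<subseteq> {1..<n - k}" "legal_index_set S L"
      "v - lid S n = (\<Sum>l\<in>L. lid S l)"
      by (auto simp: representable_def)
    have "finite L" using L(1) finite_subset by blast
    have "n \<notin> L"
    proof
      assume "n \<in> L"
      then have "n < n - k" using L(1) by auto
      then show False by simp
    qed
    have far: "nat \<bar>int n - int l\<bar> \<notin> S \<and> nat \<bar>int l - int n\<bar> \<notin> S" if "l \<in> L" for l
    proof -
      have "l < n - k" using that L(1) by auto
      then have "k < nat \<bar>int n - int l\<bar>" "k < nat \<bar>int l - int n\<bar>" using assms(3) by linarith+
      then show ?thesis using assms(2) by (meson leD)
    qed
    have "legal_index_set S (insert n L)"
      using L(2) far assms(1) by (auto simp: legal_index_set_def)
    moreover have "insert n L \<subseteq> {1..<Suc n}" using L(1) assms(3) by fastforce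
    moreover have "v = (\<Sum>l\<in>insert n L. lid S l)"
      using \<open>finite L\<close> \<open>n \<notin> L\<close> L(3) False by simp
    ultimately show ?thesis unfolding representable_def by (intro exI[of _ "insert n L"] conjI)
  qed
qed

lemma stride_sum_lid_mono:
  assumes "0 \<notin> S" "0 < m"
  shows "x \<le> y \<Longrightarrow> stride_sum m (lid S) x \<le> stride_sum m (lid S) y"
proof (induction x arbitrary: y rule: less_induct)
  case (less x)
  show ?case
  proof (cases "x = 0")
    case False
    then have "stride_sum m (lid S) (x - m) \<le> stride_sum m (lid S) (y - m)"
      using less assms(2) by simp
    moreover have "lid S x \<le> lid S y" using lid_le_lid[OF assms(1)] less.prems False by simp
    ultimately show ?thesis
      using stride_sum_rec[OF assms(2), of x "lid S"] stride_sum_rec[OF assms(2), of y "lid S"]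
        False less.prems by simp
  qed simp
qed

text \<open>Since \<open>S\<close> contains 1, ..., \<open>m - 1\<close>, removing the maximum
  \<open>x\<close> of \<open>L\<close> leaves indices at most \<open>x - m\<close>. Induction bounds
  the rest by the tail of the stride sum, and monotonicity passes from \<open>x\<close> to
  \<open>n\<close>.\<close>

lemma legal_sum_le_stride_sum:
  assumes "0 \<notin> S" "0 < m" "\<And>s. 0 < s \<Longrightarrow> s < m \<Longrightarrow> s \<in> S"
  shows "L \<subseteq> {1..n} \<Longrightarrow> legal_index_set S L \<Longrightarrow> (\<Sum>l\<in>L. lid S l) \<le> stride_sum m (lid S) n"
proof (induction n arbitrary: L rule: less_induct)
  case (less n)
  show ?case
  proof (cases "L = {}")
    case False
    have fin: "finite L" using less.prems(1) finite_subset by blast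
    define x where "x = Max L"
    have x: "x \<in> L" "\<And>l. l \<in> L \<Longrightarrow> l \<le> x" using fin False by (simp_all add: x_def)
    have xn: "1 \<le> x" "x \<le> n" using x(1) less.prems(1) by auto
    have "L - {x} \<subseteq> {1..x - m}"
    proof
      fix l assume l: "l \<in> L - {x}"
      then have "l \<in> L" "l \<noteq> x" by auto
      then have "l < x" "1 \<le> l" using x(2)[of l] less.prems(1) by auto
      moreover have "x - l \<notin> S"
        using legal_diff[OF less.prems(2) \<open>l \<in> L\<close> x(1)] \<open>l < x\<close> by simp
      ultimately have "m \<le> x - l" using assms(3)[of "x - l"] by (meson not_le zero_less_diff)
      then show "l \<in> {1..x - m}" using \<open>1 \<le> l\<close> \<open>l < x\<close> by simp
    qed
    moreover have "x - m < n" using xn assms(2) by linarith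
    ultimately have "(\<Sum>l\<in>L - {x}. lid S l) \<le> stride_sum m (lid S) (x - m)"
      by (intro less.IH[of "x - m"] legal_subset[OF less.prems(2) Diff_subset])
    moreover have "(\<Sum>l\<in>L. lid S l) = lid S x + (\<Sum>l\<in>L - {x}. lid S l)"
      using fin x(1) by (rule sum.remove)
    ultimately have "(\<Sum>l\<in>L. lid S l) \<le> stride_sum m (lid S) x"
      using stride_sum_rec[OF assms(2), of x "lid S"] xn by simp
    then show ?thesis using stride_sum_lid_mono[OF assms(1,2) xn(2)] by linarith
  qed simp
qed

lemma lid_Suc_le_stride_sum:
  assumes "0 \<notin> S" "0 < m" "\<And>s. 0 < s \<Longrightarrow> s < m \<Longrightarrow> s \<in> S"
  shows "lid S (Suc n) \<le> Suc (stride_sum m (lid S) n)"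
proof (rule lid_le)
  show "\<not> representable S (Suc n) (Suc (stride_sum m (lid S) n))"
  proof
    assume "representable S (Suc n) (Suc (stride_sum m (lid S) n))"
    then obtain L where L: "L \<subseteq> {1..<Suc n}" "legal_index_set S L"
      "Suc (stride_sum m (lid S) n) = (\<Sum>l\<in>L. lid S l)"
      by (auto simp: representable_def)
    have "L \<subseteq> {1..n}" using L(1) by (auto simp: less_Suc_eq_le)
    from legal_sum_le_stride_sum[OF assms this L(2)] show False using L(3) by simp
  qed
qed simp

text \<open>An index set containing \<open>n\<close> would have to represent \<open>lid S (n - k)\<close> without \<open>n - k\<close>: indices
  above \<open>n - k\<close> are too large, and those below it do not suffice by definition.\<close>

lemma lid_Suc_eq:
  assumes "0 \<notin> S" "0 < m" "\<And>s. 0 < s \<Longrightarrow> s < m \<Longrightarrow> s \<in> S"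
    and "k \<in> S" "\<And>s. s \<in> S \<Longrightarrow> s \<le> k" "k < n"
    and large: "stride_sum m (lid S) (n - 1) < lid S n + lid S (n - k)"
  shows "lid S (Suc n) = lid S n + lid S (n - k)"
proof (rule antisym)
  show "lid S n + lid S (n - k) \<le> lid S (Suc n)"
    using assms by (intro lid_superadditive) auto
  show "lid S (Suc n) \<le> lid S n + lid S (n - k)"
  proof (rule lid_le)
    show "\<not> representable S (Suc n) (lid S n + lid S (n - k))"
    proof
      assume "representable S (Suc n) (lid S n + lid S (n - k))"
      then obtain L where L: "L \<subseteq> {1..<Suc n}" "legal_index_set S L"
        and sum: "lid S n + lid S (n - k) = (\<Sum>l\<in>L. lid S l)"
        by (auto simp: representable_def)
      have fin: "finite L" using L(1) finite_subset by blast
      show False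
      proof (cases "n \<in> L")
        case False
        have "L \<subseteq> {1..n - 1}"
        proof
          fix l assume "l \<in> L"
          then have "1 \<le> l" "l \<le> n" "l \<noteq> n" using L(1) False by auto
          then show "l \<in> {1..n - 1}" by auto
        qed
        from legal_sum_le_stride_sum[OF assms(1-3) this L(2)] show False
          using large sum by simp
      next
        case True
        have rest: "lid S (n - k) = (\<Sum>l\<in>L - {n}. lid S l)"
          using sum sum.remove[OF fin True, of "lid S"] by simp
        have "L - {n} \<subseteq> {1..<n - k}"
        proof
          fix l assume l: "l \<in> L - {n}"
          then have l1: "1 \<le> l" "l < n" using L(1) by auto
          have "l \<noteq> n - k"
            using legal_diff[OF L(2), of l n] l True l1 \<open>k \<in> S\<close> \<open>k < n\<close> by auto
          moreover have "lid S l \<le> lid S (n - k)"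
            unfolding rest using fin l by (intro member_le_sum) auto
          then have "\<not> n - k < l"
            using lid_less[OF assms(1), of "n - k" l] \<open>k < n\<close> by (metis leD less_eq_Suc_le One_nat_def zero_less_diff)
          ultimately show "l \<in> {1..<n - k}" using l1 by auto
        qed
        then have "representable S (n - k) (lid S (n - k))"
          unfolding representable_def
          by (intro exI[of _ "L - {n}"] conjI rest legal_subset[OF L(2)] Diff_subset)
        then show False using lid_not_representable by blast
      qed
    qed
  qed (use lid_pos[of S n] in simp)
qed

text \<open>For \<open>j \<le> m\<close> the stride sum is the single term \<open>lid S j\<close>,
  so the sequence rises by at most 1 there; strict monotonicity gives the other bound.\<close>

lemma lid_initial:
  assumes "0 \<notin> S" "0 < m" "\<And>s. 0 < s \<Longrightarrow> s < m \<Longrightarrow> s \<in> S"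
  shows "1 \<le> j \<Longrightarrow> j \<le> Suc m \<Longrightarrow> lid S j = j"
proof (induction j rule: nat_induct_at_least)
  case base
  then show ?case
    using lid_pos[of S 1] lid_Suc_le_stride_sum[OF assms, of 0] by simp
next
  case (Suc j)
  then have "stride_sum m (lid S) j = j"
    using stride_sum_short[OF assms(2), of j "lid S"] by simp
  then have "lid S (Suc j) \<le> Suc j"
    using lid_Suc_le_stride_sum[OF assms, of j] by simp
  then show ?case using lid_ge_index[OF assms(1), of "Suc j"] by simp
qed

text \<open>As \<open>m\<close> is not in \<open>S\<close>, the set \<open>{1, m + 1}\<close> is
  legal and represents \<open>m + 2\<close>, which is therefore skipped. It is also the largest
  legal sum over \<open>{1..m + 1}\<close>.\<close>

lemma lid_first_gap:
  assumes "0 \<notin> S" "0 < m" "\<And>s. 0 < s \<Longrightarrow> s < m \<Longrightarrow> s \<in> S" "m \<notin> S"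
  shows "lid S (m + 2) = m + 3"
proof -
  have init: "lid S j = j" if "1 \<le> j" "j \<le> Suc m" for j
    using lid_initial[OF assms(1-3)] that by simp
  have "stride_sum m (lid S) (Suc m) = Suc m + 1"
    using stride_sum_rec[OF assms(2), of "Suc m" "lid S"] stride_sum_short[OF assms(2), of 1 "lid S"]
      init[of 1] init[of "Suc m"] assms(2) by simp
  then have "lid S (m + 2) \<le> m + 3"
    using lid_Suc_le_stride_sum[OF assms(1-3), of "Suc m"] by simp
  moreover have "m + 3 \<le> lid S (m + 2)"
  proof (rule le_lid)
    fix v assume "v < m + 3"
    moreover have "lid S (Suc m) = Suc m" "lid S 1 = 1" using init by auto
    ultimately consider "v < lid S (Suc m)" | "v = lid S (Suc m)" | "v = lid S 1 + lid S (Suc m)"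
      by linarith
    then show "representable S (m + 2) v"
    proof cases
      case 1
      from representable_mono[OF representable_less_lid[OF this], of "m + 2"] show ?thesis by simp
    next
      case 2
      then show ?thesis using representable_single[OF assms(1)] by simp
    next
      case 3
      then show ?thesis using representable_pair[OF assms(1), of 1 "Suc m" "m + 2"] assms(2,4) by simp
    qed
  qed
  ultimately show ?thesis by simp
qed

section \<open>Propagation of the strict inequality\<close>

text \<open>The locale collects the linear facts about the sequence that the propagation needs, with
  \<open>k = m + c\<close>. Its parameter \<open>b\<close> is the sequence up to index \<open>k + c + 1\<close>, continued by the recurrence, so that the
  recurrence may be used before it is known for the sequence itself.\<close>

locale lid_tail =
  fixes b :: "nat \<Rightarrow> int" and m c :: nat
  assumes c_pos: "0 < c" and m_ge: "2 * c + 1 \<le> m"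
    and b_init: "\<And>j. 1 \<le> j \<Longrightarrow> j \<le> m + 1 \<Longrightarrow> b j = int j"
    and b_gap: "b (m + 2) = int m + 3"
    and b_step_le: "\<And>s. 1 \<le> s \<Longrightarrow> s \<le> 2 * c \<Longrightarrow> b (m + s + 1) \<le> b (m + s) + int s + 1"
    and b_step_ge: "\<And>s. 1 \<le> s \<Longrightarrow> s \<le> 2 * c \<Longrightarrow> b (m + s) + 1 \<le> b (m + s + 1)"
    and b_step_ge_late: "\<And>i. 1 \<le> i \<Longrightarrow> i \<le> c \<Longrightarrow> b (m + c + i) + int i \<le> b (m + c + i + 1)"
    and b_rec: "\<And>j. c < j \<Longrightarrow> b (j + m + c + 1) = b (j + m + c) + b j"
    and F_pos_init: "\<And>N. c < N \<Longrightarrow> N \<le> m + 3 * c + 1 \<Longrightarrow> stride_sum m b (N + c) < b N + b (N + 1)"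
begin

section \<open>The functions \<open>F\<close>, \<open>g\<close>, \<open>h\<close> and their
  recurrences\<close>

definition F :: "nat \<Rightarrow> int" where
  "F N = b N + b (N + 1) - stride_sum m b (N + c)"

definition g :: "nat \<Rightarrow> int" where
  "g N = b N + b (N + 1) - b (N + c + 2)"

text \<open>The shift by \<open>k + 1\<close> turns the recurrence of \<open>g\<close> into
  \<open>h (j + 1) = h j + g (j + 1)\<close>, so \<open>h\<close> accumulates earlier values of
  \<open>g\<close>.\<close>

definition h :: "nat \<Rightarrow> int" where
  "h j = g (j + m + c + 1)"

lemma m_pos: "0 < m"
  using m_ge by simp

lemma g_step: "c < j \<Longrightarrow> g (j + m + c + 1) = g (j + m + c) + g j"
  using b_rec[of j] b_rec[of "j + 1"] b_rec[of "j + c + 2"]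
  by (simp add: g_def algebra_simps)

lemma h_step: "c \<le> j \<Longrightarrow> h (j + 1) = h j + g (j + 1)"
  using g_step[of "j + 1"] by (simp add: h_def algebra_simps)

text \<open>Two uses of the recurrence give
  \<open>b (j + m + c + 2) = b (j + m + c) + b j + b (j + 1)\<close>, while the stride sum gains
  exactly the term \<open>b (j + m + c)\<close>.\<close>

lemma F_step: "c < j \<Longrightarrow> F (j + m) = F j + g (j + m)"
  using b_rec[of j] b_rec[of "j + 1"] stride_sum_rec[OF m_pos, of "j + m + c" b]
  by (simp add: F_def g_def algebra_simps)

text \<open>The window has \<open>m + c + 1\<close> arguments, the order of the recurrence.
  Nonnegativity of \<open>g\<close> therefore spreads to all later arguments, and from
  \<open>N0\<close> on \<open>F N\<close> is at least \<open>F (N - m)\<close>.\<close>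

lemma F_pos_if_window:
  assumes N0: "m + c + 1 \<le> N0"
    and window: "\<And>N. N0 \<le> N \<Longrightarrow> N \<le> N0 + m + c \<Longrightarrow> 0 \<le> g N"
    and below: "\<And>N. c < N \<Longrightarrow> N < N0 \<Longrightarrow> 0 < F N"
  shows "c < N \<Longrightarrow> 0 < F N"
proof -
  have g_nonneg: "N0 \<le> N \<Longrightarrow> 0 \<le> g N" for N
  proof (induction N rule: less_induct)
    case (less N)
    show ?case
    proof (cases "N \<le> N0 + m + c")
      case False
      define j where "j = N - (m + c + 1)"
      have j: "N = j + m + c + 1" "N0 \<le> j" using False by (auto simp: j_def)
      have "0 \<le> g (j + m + c)" "0 \<le> g j" using less.IH j by auto
      then show ?thesis using g_step[of j] j N0 by simp
    qed (use less.prems window in simp)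
  qed
  show "c < N \<Longrightarrow> 0 < F N"
  proof (induction N rule: less_induct)
    case (less N)
    show ?case
    proof (cases "N < N0")
      case False
      define j where "j = N - m"
      have j: "N = j + m" "c < j" using False N0 by (auto simp: j_def)
      have "0 < F j" using less.IH j m_pos by simp
      then show ?thesis using F_step[of j] g_nonneg[of N] j False by simp
    qed (use less.prems below in simp)
  qed
qed

section \<open>Bounds on \<open>b\<close> between \<open>m\<close> and \<open>2 * m\<close>\<close>

lemma stride_sum_short_b: "1 \<le> x \<Longrightarrow> x \<le> m \<Longrightarrow> stride_sum m b x = int x"
  using stride_sum_short[OF m_pos, of x b] b_init[of x] by simp

lemma stride_sum_two: "1 \<le> x \<Longrightarrow> x \<le> m \<Longrightarrow> stride_sum m b (m + x) = b (m + x) + int x"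
  using stride_sum_rec[OF m_pos, of "m + x" b] stride_sum_short_b[of x] by simp

text \<open>The instances of (iii) whose stride sum has exactly two terms, the second one being
  explicit. They supply the upper bounds on \<open>b\<close> used below.\<close>

lemma two_term_bound:
  assumes "1 \<le> x" "x \<le> m" "m + x = N + c" "c < N" "N \<le> m + 3 * c + 1"
  shows "b (m + x) + int x < b N + b (N + 1)"
  using F_pos_init[OF assms(4,5)] stride_sum_two[OF assms(1,2)] assms(3) by simp

lemma b_ge_index:
  assumes "1 \<le> j" "j \<le> m + 2 * c + 1"
  shows "int j \<le> b j"
proof (cases "j \<le> m + 1")
  case False
  have "s \<le> 2 * c \<Longrightarrow> int (m + s + 1) \<le> b (m + s + 1)" for s
  proof (induction s)
    case 0
    then show ?case using b_init[of "m + 1"] by simp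
  next
    case (Suc s)
    then show ?case using b_step_ge[of "Suc s"] by simp
  qed
  from this[of "j - m - 1"] show ?thesis using False assms by simp
qed (use b_init assms in simp)

lemma le_stride_sum:
  assumes "1 \<le> j" "j \<le> m + 2 * c + 1"
  shows "int j \<le> stride_sum m b j"
  using assms
proof (induction j rule: less_induct)
  case (less j)
  have "0 \<le> stride_sum m b (j - m)"
  proof (cases "j \<le> m")
    case False
    then have "int (j - m) \<le> stride_sum m b (j - m)"
      using less.prems m_pos by (intro less.IH) auto
    then show ?thesis by linarith
  qed simp
  then show ?case
    using stride_sum_rec[OF m_pos, of j b] b_ge_index[OF less.prems] less.prems by simp
qed

lemma b_le_linear:
  assumes "1 \<le> s" "s \<le> c"
  shows "b (m + s) + 2 * int c \<le> 2 * int m + int s"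
proof -
  \<comment> \<open>With this choice \<open>N\<close> and \<open>N + 1\<close> are still at most
    \<open>m + 1\<close>, so the right-hand side of the two-term bound is
    \<open>2 * N + 1\<close>.\<close>
  define N where "N = m - c + s"
  have N: "m + s = N + c" "c < N" "N \<le> m" using assms m_ge by (auto simp: N_def)
  have "b (m + s) + int s < b N + b (N + 1)"
    using two_term_bound[of s N] N assms m_ge by linarith
  moreover have "b N = int N" "b (N + 1) = int N + 1"
    using b_init[of N] b_init[of "N + 1"] N by auto
  ultimately show ?thesis using N(1) by linarith
qed

lemma b_k1_le: "b (m + c + 1) + int c \<le> 2 * int m + 2"
  using two_term_bound[of "c + 1" "m + 1"] m_ge c_pos b_init[of "m + 1"] b_gap by simp

lemma b_m3_le: "b (m + 2 + 1) \<le> int m + 6"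
  using b_step_le[of 2] b_gap c_pos by simp

lemma b_k2_le: "b (m + c + 2) + int c \<le> 2 * int m + 6"
  using two_term_bound[of "c + 2" "m + 2"] m_ge c_pos b_gap b_m3_le by simp

lemma b_tail_step:
  assumes "i + c \<le> m"
  shows "b (m + 2 * c + 1 + Suc i) = b (m + 2 * c + 1 + i) + int (c + i + 1)"
proof -
  have ix: "m + 2 * c + 1 + Suc i = (c + i + 1) + m + c + 1" "m + 2 * c + 1 + i = (c + i + 1) + m + c"
    by auto
  show ?thesis
    unfolding ix using b_rec[of "c + i + 1"] b_init[of "c + i + 1"] assms by simp
qed

text \<open>The recurrence adds values \<open>b j = j\<close>, so the increments form an arithmetic
  progression. The equation is doubled to avoid halving.\<close>

lemma b_tail:
  "i + c \<le> m + 1 \<Longrightarrow>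
    2 * b (m + 2 * c + 1 + i) = 2 * b (m + 2 * c + 1) + 2 * int c * int i + int i * (int i + 1)"
proof (induction i)
  case (Suc i)
  then show ?case using b_tail_step[of i] by (simp add: algebra_simps)
qed simp

text \<open>With \<open>k = m + c\<close>, the value of \<open>b (k + c + 1)\<close> is squeezed between a quadratic function of
  \<open>c\<close> and a linear function of \<open>m\<close> and \<open>c\<close>.\<close>

lemma quadratic_bound: "3 * (int c)\<^sup>2 + 13 * int c \<le> 8 * int m + 10"
proof -
  let ?A = "b (m + 2 * c + 1)"
  have "b (m + (2 * c + 1)) + int (2 * c + 1) < b (m + c + 1) + b (m + c + 1 + 1)"
    by (rule two_term_bound) (use m_ge in linarith)+
  then have upper: "?A + 4 * int c \<le> 4 * int m + 6"
    using b_k1_le b_k2_le by (simp add: add.assoc)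
  \<comment> \<open>At \<open>N = m + 2 * c + 1\<close> the quantity \<open>?A\<close> occurs twice
    on the right but once on the left, next to a quadratic term from \<open>b_tail\<close>. This
    yields a quadratic lower bound for \<open>?A\<close>.\<close>
  have "stride_sum m b (m + 2 * c + 1 + c) < ?A + b (m + 2 * c + 1 + 1)"
    by (rule F_pos_init) linarith+
  moreover have "m + 2 * c + 1 + c - m = 3 * c + 1" by simp
  then have "stride_sum m b (m + 2 * c + 1 + c) = b (m + 2 * c + 1 + c) + stride_sum m b (3 * c + 1)"
    using stride_sum_rec[OF m_pos, of "m + 2 * c + 1 + c" b] by (simp only: zero_less_Suc add_gr_0 zero_less_one simp_thms True_implies_equals)
  moreover have "int (3 * c + 1) \<le> stride_sum m b (3 * c + 1)"
    by (rule le_stride_sum) (use m_ge in linarith)+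
  moreover have "2 * b (m + 2 * c + 1 + c) = 2 * ?A + 2 * int c * int c + int c * (int c + 1)"
    by (rule b_tail) (use m_ge in simp)
  moreover have "2 * b (m + 2 * c + 1 + 1) = 2 * ?A + 2 * int c + 2"
    using b_tail[of 1] m_ge by simp
  ultimately have "2 * int c * int c + int c * (int c + 1) + 4 * int c + 2 \<le> 2 * ?A"
    by linarith
  then have "3 * (int c * int c) + 5 * int c + 2 \<le> 2 * ?A"
    by (simp add: algebra_simps)
  with upper show ?thesis by (simp add: power2_eq_square)
qed

section \<open>Lower bounds for \<open>g\<close> on successive stretches\<close>

lemma h_c: "h c = g (m + 2 * c + 1)"
  by (simp add: h_def mult_2 add.commute add.left_commute)

lemma g_init: "c < j \<Longrightarrow> j + c + 1 \<le> m \<Longrightarrow> g j = int j - int c - 1"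
  using b_init[of j] b_init[of "j + 1"] b_init[of "j + c + 2"] by (simp add: g_def)

lemma g_m_minus_c: "g (m - c) = int m - 2 * int c - 2"
proof -
  have "m - c + c + 2 = m + 2" "1 \<le> m - c" using m_ge by auto
  then show ?thesis
    using b_init[of "m - c"] b_init[of "m - c + 1"] b_gap c_pos m_ge
    by (simp only: g_def)
qed

lemma g_m_minus_c1: "2 \<le> c \<Longrightarrow> int m - 2 * int c - 3 \<le> g (m - c + 1)"
proof -
  assume "2 \<le> c"
  have "m - c + 1 + c + 2 = m + 2 + 1" "1 \<le> m - c" using m_ge by auto
  then show ?thesis
    using b_init[of "m - c + 1"] b_init[of "m - c + 1 + 1"] b_m3_le \<open>2 \<le> c\<close> m_ge
    by (simp only: g_def)
qed

lemma g_rising: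
  assumes "t + 2 \<le> c"
  shows "int t - 1 \<le> g (m - c + t)"
proof -
  have "m - c + t + c + 2 = m + (t + 2)" using m_ge by simp
  then have "b (m - c + t + c + 2) + 2 * int c \<le> 2 * int m + int (t + 2)"
    using b_le_linear[of "t + 2"] assms by (simp only:)
  then show ?thesis
    using b_init[of "m - c + t"] b_init[of "m - c + t + 1"] assms m_ge
    by (simp add: g_def of_nat_diff)
qed

lemma g_m_minus_1: "int c - 3 \<le> g (m - 1)"
proof -
  have "m - 1 + c + 2 = m + c + 1" "1 \<le> m - 1" using m_ge c_pos by auto
  then show ?thesis
    using b_init[of "m - 1"] b_init[of "m - 1 + 1"] b_k1_le m_ge
    by (simp only: g_def)
qed

text \<open>The two-term bound at \<open>N = m + r + 2\<close> controls the negative term of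
  \<open>g\<close>; the step bounds then compare arguments \<open>m + r + 2\<close> and
  \<open>m + r + 3\<close> with \<open>m + r\<close> and \<open>m + r + 1\<close>, at a total cost
  of \<open>4 * r + 8\<close>.\<close>

lemma g_falling:
  assumes "r + 1 \<le> c"
  shows "int c - 3 * int r - 5 \<le> g (m + r)"
proof -
  have "b (m + (c + r + 2)) + int (c + r + 2) < b (m + r + 2) + b (m + r + 2 + 1)"
    by (rule two_term_bound) (use m_ge assms in linarith)+
  moreover have "b (m + r + 2 + 1) \<le> b (m + r + 2) + int r + 3"
    using b_step_le[of "r + 2"] assms by (simp add: add.assoc)
  moreover have "b (m + r + 2) \<le> b (m + r + 1) + int r + 2"
    using b_step_le[of "r + 1"] assms by simp
  moreover have "b (m + r + 1) \<le> b (m + r) + int r + 1"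
    using b_step_le[of r] b_init[of m] b_init[of "m + 1"] m_ge assms by (cases "r = 0") auto
  moreover have "m + r + c + 2 = m + (c + r + 2)" by simp
  ultimately show ?thesis by (simp only: g_def)
qed

lemma g_k: "- int c - 1 \<le> g (m + c)"
proof -
  have "b (m + 2 * c) + int (2 * c) < b (m + c) + b (m + c + 1)"
    by (rule two_term_bound) (use m_ge c_pos in linarith)+
  moreover have "b (m + 2 * c + 1) \<le> b (m + 2 * c) + int (2 * c) + 1"
    using b_step_le[of "2 * c"] c_pos by simp
  moreover have "2 * b (m + 2 * c + 1 + 1) = 2 * b (m + 2 * c + 1) + 2 * int c + 2"
    using b_tail[of 1] m_ge by simp
  moreover have "m + c + c + 2 = m + 2 * c + 1 + 1" by simp
  ultimately show ?thesis by (simp only: g_def)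
qed

text \<open>Two tail steps past \<open>m + 2 * c + i\<close> cost \<open>2 * c + 2 * i + 1\<close>,
  and the two-term bound returns \<open>2 * c + i + 1\<close>.\<close>

lemma g_after_k:
  assumes "1 \<le> i" "i \<le> c + 1" "3 * c + 1 \<le> m"
  shows "- int i \<le> g (m + c + i)"
proof -
  have "b (m + (2 * c + i)) + int (2 * c + i) < b (m + c + i) + b (m + c + i + 1)"
    by (rule two_term_bound) (use assms in linarith)+
  moreover have "b (m + 2 * c + 1 + Suc i) = b (m + 2 * c + 1 + i) + int (c + i + 1)"
    by (rule b_tail_step) (use assms in linarith)
  moreover have "b (m + 2 * c + 1 + i) = b (m + (2 * c + i)) + int (c + i)"
    using b_tail_step[of "i - 1"] assms by (cases i) (simp_all add: add.assoc)
  moreover have "m + c + i + c + 2 = m + 2 * c + 1 + Suc i" by simp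
  ultimately show ?thesis by (simp only: g_def)
qed

lemma g0_ge: "3 * c + 1 \<le> m \<Longrightarrow> - int c - 1 \<le> g (m + 2 * c + 1)"
  using g_after_k[of "c + 1"] by (simp add: mult_2 add.assoc)

text \<open>For \<open>c = 1\<close> the bound \<open>- c - 1\<close> is too weak to start the
  estimate of \<open>h\<close>; superadditivity in the form \<open>b_step_ge_late\<close> gives a
  better one.\<close>

lemma g0_ge_one:
  assumes "c = 1"
  shows "int m - 3 \<le> g (m + 2 * c + 1)"
proof -
  have "b (m + c + 1) + 1 \<le> b (m + c + 1 + 1)"
    using b_step_ge_late[of 1] assms by simp
  moreover have "m + c + 1 = m + 2" "m + c + 1 + 1 = m + 2 * c + 1" using assms by auto
  ultimately have "b (m + 2) + 1 \<le> b (m + 2 * c + 1)" by metis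
  moreover have "2 * b (m + 2 * c + 1 + 1) = 2 * b (m + 2 * c + 1) + 2 * int c + 2"
    using b_tail[of 1] m_ge by simp
  moreover have "2 * b (m + 2 * c + 1 + 3) = 2 * b (m + 2 * c + 1) + 6 * int c + 12"
    using b_tail[of 3] m_ge assms by simp
  moreover have "m + 2 * c + 1 + c + 2 = m + 2 * c + 1 + 3" using assms by simp
  moreover have "int c = 1" using assms by simp
  ultimately show ?thesis using b_gap by (simp only: g_def)
qed

section \<open>Nonnegativity of \<open>h\<close>\<close>

lemma h_init:
  assumes "m = u + 2 * c + 2"
  shows "i \<le> u + 1 \<Longrightarrow> 2 * h (c + i) = 2 * h c + int i * (int i - 1)"
proof (induction i)
  case (Suc i)
  \<comment> \<open>On the explicit stretch from \<open>c + 1\<close> to \<open>m - c - 1\<close>,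
    \<open>g\<close> runs through 0, ..., \<open>u\<close>.\<close>
  have "g (c + i + 1) = int i"
    using g_init[of "c + i + 1"] Suc.prems assms by simp
  then show ?case
    using Suc h_step[of "c + i"] by (simp add: algebra_simps)
qed simp

text \<open>\<open>h\<close> is the sum of \<open>g\<close> over stretches on which the preceding lemmas bound \<open>g\<close> from below; only
  the stretches from \<open>m\<close> to \<open>m + 2 * c\<close> and just after \<open>m + 2 * c\<close> can decrease it.\<close>

lemma h_nonneg:
  assumes m: "m = u + 2 * c + 2" and "c \<le> u"
    and e: "e = 0 \<or> 3 \<le> c \<and> e = 2 * (int u - 1)"
    and large: "2 * (int c)\<^sup>2 + 34 * int c + 12 + (int c + 3)\<^sup>2 \<le> 2 * (int u * (int u + 3) + e)"
    and j: "2 * c + 1 \<le> j" "j \<le> m + 3 * c + 1"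
  shows "0 \<le> h j"
proof -
  have "3 * c + 1 \<le> m" using m \<open>c \<le> u\<close> by simp
  then have h_c_ge: "- int c - 1 \<le> h c" using g0_ge h_c by simp
  \<comment> \<open>Twice the sum of 0, ..., \<open>u\<close>, plus \<open>2 * u\<close> from
    \<open>g (m - c) = u\<close>.\<close>
  let ?P = "int u * (int u + 3)"
  have stretch0: "2 * h (m - c) = 2 * h c + ?P"
  proof -
    have "m - c = c + (u + 1) + 1" using m by simp
    then have "h (m - c) = h (c + (u + 1)) + g (m - c)"
      using h_step[of "c + (u + 1)"] by simp
    then show ?thesis
      using h_init[OF m, of "u + 1"] g_m_minus_c m by (simp add: algebra_simps)
  qed
  have stretch1: "2 * h c + ?P + e + int t * (int t - 1) \<le> 2 * h (m - c + t)"
    if "1 \<le> t" "t + 2 \<le> c" for t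
    using that
  proof (induction t rule: nat_induct_at_least)
    case base
    \<comment> \<open>The term \<open>e\<close> records the extra gain at this one argument, where
      \<open>b (m + 3) \<le> m + 6\<close> gives \<open>g \<ge> u - 1\<close>; it is available once
      \<open>c \<ge> 3\<close>.\<close>
    have "e \<le> 2 * g (m - c + 1)"
      using e g_m_minus_c1 g_rising[of 1] m \<open>c \<le> u\<close> base by fastforce
    then show ?case
      using stretch0 h_step[of "m - c"] m by simp
  next
    case (Suc t)
    then show ?case
      using g_rising[of "Suc t"] h_step[of "m - c + t"] m by (simp add: algebra_simps)
  qed
  have c2: "(int c)\<^sup>2 = int c * int c" by (simp add: power2_eq_square)
  have stretch2: "2 * h c + ?P + e + (int c)\<^sup>2 - 3 * int c \<le> 2 * h (m - 1)"
  proof -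
    consider "c = 1" | "c = 2" | "3 \<le> c" using c_pos by linarith
    then show ?thesis
    proof cases
      case 1
      then show ?thesis using stretch0 e by simp
    next
      case 2
      then have "m - 1 = m - c + 1" using m by simp
      then have "h (m - 1) = h (m - c) + g (m - 1)" using h_step[of "m - c"] m by simp
      then show ?thesis using stretch0 g_m_minus_1 e 2 by simp
    next
      case 3
      then have ix: "m - 1 = m - c + (c - 2) + 1" using m by simp
      then have "h (m - 1) = h (m - c + (c - 2)) + g (m - 1)"
        using h_step[of "m - c + (c - 2)"] m by (simp only: ix)
      moreover have "2 * h c + ?P + e + int (c - 2) * (int (c - 2) - 1) \<le> 2 * h (m - c + (c - 2))"
        by (rule stretch1) (use 3 in linarith)+
      moreover have "int (c - 2) = int c - 2" using 3 by simp
      then have "int (c - 2) * (int (c - 2) - 1) = (int c)\<^sup>2 - 5 * int c + 6"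
        by (simp add: algebra_simps c2)
      ultimately show ?thesis using g_m_minus_1 by linarith
    qed
  qed
  have stretch3: "2 * h c + ?P + e + (int c)\<^sup>2 - 3 * int c + (int r + 1) * (2 * int c - 10 - 3 * int r)
      \<le> 2 * h (m + r)" if "r + 1 \<le> c" for r
    using that
  proof (induction r)
    case 0
    have "h m = h (m - 1) + g m" using h_step[of "m - 1"] m by simp
    then show ?case using stretch2 g_falling[of 0] 0 by simp
  next
    case (Suc r)
    then show ?case
      using g_falling[of "Suc r"] h_step[of "m + r"] m by (simp add: algebra_simps)
  qed
  have stretch4: "2 * h c + ?P + e - 12 * int c - 2 - int i * (int i + 1) \<le> 2 * h (m + c + i)"
    if "i \<le> c" for i
    using that
  proof (induction i)
    case 0
    have ix: "m + c = m + (c - 1) + 1" "int (c - 1) = int c - 1" using c_pos by auto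
    then have "h (m + c) = h (m + (c - 1)) + g (m + c)"
      using h_step[of "m + (c - 1)"] m by simp
    then show ?case
      using stretch3[of "c - 1"] g_k ix(2) c_pos by (simp add: algebra_simps c2)
  next
    case (Suc i)
    then show ?case
      using g_after_k[of "Suc i"] h_step[of "m + c + i"] m \<open>3 * c + 1 \<le> m\<close>
      by (simp add: algebra_simps)
  qed
  \<comment> \<open>Past \<open>m + 2 * c\<close> the increments of \<open>h\<close> are themselves
    values of \<open>h\<close>, starting with \<open>h c\<close>.\<close>
  have stretch5: "2 * h (m + 2 * c) + 2 * (int i + 1) * h c + 2 * int i * (int i - 2)
      \<le> 2 * h (m + 2 * c + 1 + i)" if "i \<le> c" for i
    using that
  proof (induction i)
    case 0
    have "h (m + 2 * c + 1) = h (m + 2 * c) + g (m + 2 * c + 1)"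
      using h_step[of "m + 2 * c"] m by simp
    then show ?case using h_c by simp
  next
    case (Suc i)
    have "h (c + Suc i) = g (m + 2 * c + 1 + i + 1)"
      by (simp add: h_def mult_2 add.commute add.left_commute)
    then have "h (m + 2 * c + 1 + Suc i) = h (m + 2 * c + 1 + i) + h (c + Suc i)"
      using h_step[of "m + 2 * c + 1 + i"] by simp
    moreover have "2 * h (c + Suc i) = 2 * h c + (int i + 1) * int i"
      using h_init[OF m, of "Suc i"] Suc.prems \<open>c \<le> u\<close> by simp
    \<comment> \<open>Replaces \<open>i * (i + 1)\<close> by the smaller \<open>4 * i - 2\<close>,
      so that the accumulated bound stays quadratic in \<open>i\<close>.\<close>
    moreover have "0 \<le> (int i - 1) * (int i - 2)"
      by (cases "i \<le> 1") (auto intro: mult_nonpos_nonpos)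
    ultimately show ?case using Suc by (simp add: algebra_simps)
  qed
  have e_nonneg: "0 \<le> e" using e \<open>c \<le> u\<close> by auto
  have large': "2 * (int c * int c) + 34 * int c + 12 + (int c + 3) * (int c + 3) \<le> 2 * ?P + 2 * e"
    using large by (simp add: power2_eq_square)
  have cc: "0 \<le> int c * int c" "0 \<le> (int c + 3) * (int c + 3)" by auto
  have lin: "12 * int c + 2 \<le> ?P + e" using large' cc by linarith
  have "int c * (int c + 1) = int c * int c + int c" by (simp add: algebra_simps)
  then have quad: "int c * (int c + 1) + 14 * int c + 4 \<le> ?P + e" using large' cc by linarith
  consider "j \<le> c + u + 1" | "j = m - c" | "m - c < j" "j + 2 \<le> m" | "j = m - 1"
    | "m \<le> j" "j < m + c" | "m + c \<le> j" "j \<le> m + 2 * c" | "m + 2 * c < j"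
    using m by linarith
  then show ?thesis
  proof cases
    case 1
    define i where "i = j - c"
    have i: "j = c + i" "c + 1 \<le> i" "i \<le> u + 1" using 1 j by (auto simp: i_def)
    have "(int c + 1) * int c \<le> int i * (int i - 1)"
      using i by (intro mult_mono) auto
    moreover have "0 \<le> 2 * h c + (int c + 1) * int c"
    proof (cases "c = 1")
      case True
      then show ?thesis using g0_ge_one h_c m by simp
    next
      case False
      then have "0 \<le> (int c + 1) * (int c - 2)" using c_pos by simp
      then show ?thesis using h_c_ge by (simp add: algebra_simps)
    qed
    ultimately show ?thesis using h_init[OF m i(3)] i(1) by simp
  next
    case 2
    have "int c * (int c + 3) \<le> ?P" using \<open>c \<le> u\<close> by (intro mult_mono) auto
    moreover have "int c * 4 \<le> int c * (int c + 3)" using c_pos by (intro mult_left_mono) auto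
    ultimately have "0 \<le> 2 * h (m - c)" using stretch0 h_c_ge c_pos by linarith
    then show ?thesis using 2 by simp
  next
    case 3
    define t where "t = j - (m - c)"
    have t: "j = m - c + t" "1 \<le> t" "t + 2 \<le> c" using 3 m by (auto simp: t_def)
    have "0 \<le> int t * (int t - 1)" using t by simp
    then show ?thesis unfolding t(1) using stretch1[OF t(2,3)] lin h_c_ge c_pos by linarith
  next
    case 4
    show ?thesis unfolding 4 using stretch2 lin h_c_ge c_pos c2 cc by linarith
  next
    case 5
    define r where "r = j - m"
    have r: "j = m + r" "r + 1 \<le> c" using 5 by (auto simp: r_def)
    \<comment> \<open>The product is the difference of the two sides of the next inequality; the
      worst case is \<open>r = c - 1\<close>.\<close>
    have "0 \<le> (int c - int r - 1) * (3 * int r + int c + 10)" using r by simp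
    then have "- (10 * int c) \<le> (int c)\<^sup>2 - 3 * int c + (int r + 1) * (2 * int c - 10 - 3 * int r)"
      by (simp add: algebra_simps c2)
    then show ?thesis unfolding r(1) using stretch3[OF r(2)] lin h_c_ge by linarith
  next
    case 6
    define i where "i = j - (m + c)"
    have i: "j = m + c + i" "i \<le> c" using 6 by (auto simp: i_def)
    have "int i * (int i + 1) \<le> int c * (int c + 1)" using i by (intro mult_mono) auto
    then show ?thesis
      unfolding i(1) using stretch4[OF i(2)] quad h_c_ge by linarith
  next
    case 7
    define i where "i = j - (m + 2 * c + 1)"
    have i: "j = m + 2 * c + 1 + i" "i \<le> c" using 7 j(2) by (auto simp: i_def)
    have "m + 2 * c = m + c + c" by simp
    then have "2 * h c + ?P + e - 12 * int c - 2 - int c * (int c + 1) \<le> 2 * h (m + 2 * c)"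
      using stretch4[of c] by (simp only: order_refl)
    moreover have "2 * (int i + 1) * (- int c - 1) \<le> 2 * (int i + 1) * h c"
      using h_c_ge by (intro mult_left_mono) auto
    \<comment> \<open>Completing the square in \<open>i\<close>; what remains is exactly the
      hypothesis \<open>large\<close>.\<close>
    moreover have "0 \<le> (int c + 3 - 2 * int i) * (int c + 3 - 2 * int i)" by simp
    ultimately show ?thesis
      unfolding i(1) using stretch5[OF i(2)] large' h_c_ge by (simp add: algebra_simps)
  qed
qed

section \<open>Finite windows and a criterion uniform in \<open>m\<close>\<close>

definition window :: "nat \<Rightarrow> bool" where
  "window N0 \<longleftrightarrow> list_all (\<lambda>N. 0 < F N) [m + 3 * c + 2..<N0] \<and>
     list_all (\<lambda>N. 0 \<le> g N) [N0..<N0 + m + c + 1]"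

lemma F_pos_base: "c < N \<Longrightarrow> N \<le> m + 3 * c + 1 \<Longrightarrow> 0 < F N"
  using F_pos_init[of N] by (simp add: F_def)

lemma F_pos_if_window_list:
  assumes "window N0" "m + 3 * c + 2 \<le> N0" "c < N"
  shows "0 < F N"
proof (rule F_pos_if_window[of N0, OF _ _ _ assms(3)])
  show "0 < F N" if "c < N" "N < N0" for N
  proof (cases "N < m + 3 * c + 2")
    case True
    then show ?thesis using F_pos_base that by simp
  qed (use assms(1) that in \<open>auto simp: window_def list_all_iff\<close>)
qed (use assms(1,2) in \<open>auto simp: window_def list_all_iff\<close>)

text \<open>The window starts at \<open>m + 3 * c + 2\<close>, the first argument not covered by
  \<open>F_pos_init\<close>; the shift in \<open>h\<close> moves it to the stated range of
  \<open>j\<close>.\<close>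

lemma h_nonneg_imp_F_pos:
  assumes "\<And>j. 2 * c + 1 \<le> j \<Longrightarrow> j \<le> m + 3 * c + 1 \<Longrightarrow> 0 \<le> h j" "c < N"
  shows "0 < F N"
proof (rule F_pos_if_window_list[OF _ order_refl assms(2)])
  show "window (m + 3 * c + 2)"
    unfolding window_def list_all_iff set_upt
  proof (intro conjI ballI)
    fix N assume "N \<in> {m + 3 * c + 2..<m + 3 * c + 2 + m + c + 1}"
    then have N: "m + 3 * c + 2 \<le> N" "N \<le> m + 3 * c + 2 + m + c"
      unfolding atLeastLessThan_iff by linarith+
    define j where "j = N - (m + c + 1)"
    have j: "N = j + m + c + 1" "2 * c + 1 \<le> j" "j \<le> m + 3 * c + 1" using N by (auto simp: j_def)
    show "0 \<le> g N" using assms(1)[OF j(2,3)] j(1) by (simp add: h_def)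
  qed simp
qed

text \<open>The condition of \<open>h_nonneg\<close> is monotone in
  \<open>u = m - 2 * c - 2\<close>, so one numerical check at a lower bound \<open>v\<close> covers
  all larger \<open>m\<close>.\<close>

lemma F_pos_uniform:
  assumes "v + 2 * c + 2 \<le> m" "c \<le> v"
    and large: "2 * (int c)\<^sup>2 + 34 * int c + 12 + (int c + 3)\<^sup>2
      \<le> 2 * (int v * (int v + 3) + (if 3 \<le> c then 2 * (int v - 1) else 0))"
    and "c < N"
  shows "0 < F N"
proof -
  define u where "u = m - 2 * c - 2"
  have u: "m = u + 2 * c + 2" "v \<le> u" using assms(1) by (auto simp: u_def)
  have "int v * (int v + 3) \<le> int u * (int u + 3)" using u(2) by (intro mult_mono) auto
  then have "2 * (int c)\<^sup>2 + 34 * int c + 12 + (int c + 3)\<^sup>2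
      \<le> 2 * (int u * (int u + 3) + (if 3 \<le> c then 2 * (int u - 1) else 0))"
    using large u(2) by (cases "3 \<le> c") auto
  then show ?thesis
    using u assms(2,4)
    by (intro h_nonneg_imp_F_pos[OF h_nonneg[of u "if 3 \<le> c then 2 * (int u - 1) else 0"]]) auto
qed

text \<open>For \<open>(m, c) = (3, 1)\<close> the polynomial \<open>x ^ 5 - x ^ 4 - 1\<close> of the recurrence factors as
  \<open>(x\<^sup>2 - x + 1) * (x ^ 3 - x - 1)\<close>, so \<open>g\<close> and \<open>F\<close> have period 6.\<close>

lemma F_pos_3_1:
  assumes mc: "m = 3" "c = 1" and "c < N"
  shows "0 < F N"
proof -
  \<comment> \<open>Up to sign \<open>g\<close> applies the factor \<open>x ^ 3 - x - 1\<close> to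
    \<open>b\<close>, so it is annihilated by \<open>x\<^sup>2 - x + 1\<close>, a divisor of
    \<open>x ^ 3 + 1\<close>.\<close>
  have g: "g (N + 3) = - g N" if "2 \<le> N" for N
  proof -
    have "b (N + 5) = b (N + 4) + b N" "b (N + 6) = b (N + 5) + b (N + 1)"
      using b_rec[of N] b_rec[of "N + 1"] that mc by (simp_all add: numeral_eq_Suc)
    then show ?thesis unfolding g_def by (simp add: mc numeral_eq_Suc)
  qed
  have F: "F (N + 6) = F N" if "2 \<le> N" for N
    using F_step[of N] F_step[of "N + 3"] g[of "N + 3"] that mc by (simp add: add.assoc)
  have "2 \<le> N" using assms by simp
  then show ?thesis
  proof (induction N rule: less_induct)
    case (less N)
    show ?case
    proof (cases "N \<le> 7")
      case True
      then show ?thesis using less.prems by (intro F_pos_base) (simp_all add: mc)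
    next
      case False
      then show ?thesis using F[of "N - 6"] less.IH[of "N - 6"] by simp
    qed
  qed
qed

section \<open>The small cases\<close>

lemma upt_1_numeral: "[1..<numeral n] = (if (1::nat) < numeral n then 1 # [2..<numeral n] else [])"
  by (simp add: upt_rec numeral_2_eq_2)

lemma b_Suc_0: "b (Suc 0) = 1"
  using b_init[of 1] by simp

text \<open>Stated with \<open>list_all\<close> over intervals so that numeral values of
  \<open>m\<close> and \<open>c\<close> let the simplifier expand everything into explicit linear
  equations and inequalities.\<close>

lemma linear_facts:
  "list_all (\<lambda>N. 0 < F N) [c + 1..<m + 3 * c + 2]"
  "list_all (\<lambda>j. b j = int j) [1..<m + 2]"
  "list_all (\<lambda>s. b (m + s + 1) \<le> b (m + s) + int s + 1) [1..<2 * c + 1]"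
  "list_all (\<lambda>s. b (m + s) + 1 \<le> b (m + s + 1)) [1..<2 * c + 1]"
  "list_all (\<lambda>i. b (m + c + i) + int i \<le> b (m + c + i + 1)) [1..<c + 1]"
  "list_all (\<lambda>j. b (j + m + c + 1) = b (j + m + c) + b j) [c + 1..<3 * c + 3]"
  "list_all (\<lambda>N. F N = b N + b (N + 1) - stride_sum m b (N + c)) [c + 1..<m + 3 * c + 2]"
  "list_all (\<lambda>N. g N = b N + b (N + 1) - b (N + c + 2)) [c + 1..<m + 2 * c + 2]"
  "b (m + 2) = int m + 3"
  unfolding list_all_iff set_upt
  using F_pos_init b_gap
  by - (intro ballI F_pos_init b_init b_step_le b_step_ge b_step_ge_late b_rec F_step g_step
      F_def g_def; simp add: F_def)+

lemma step_facts:
  "list_all (\<lambda>j. F (j + m) = F j + g (j + m)) [3 * c + 2..<n - m]"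
  "list_all (\<lambda>j. g (j + m + c + 1) = g (j + m + c) + g j) [c + 1..<n]"
  unfolding list_all_iff set_upt by (intro ballI F_step g_step; simp)+

context
  notes [simp] = upt_1_numeral b_Suc_0 stride_sum_rec and [simp del] = One_nat_def
begin

text \<open>The equations rewrite all terms to linear expressions in \<open>b (m + 3)\<close>, ...,
  \<open>b (m + 2 * c + 1)\<close>; the inequalities then decide each conjunct. The remaining window
  lemmas follow the same pattern.\<close>

lemma window_4_1:
  assumes mc: "m = 4" "c = 1"
  shows "window 9"
proof -
  note facts = linear_facts[unfolded mc, simplified]
  note [simp] = facts(2,6-9) step_facts[of 9, unfolded mc, simplified]
  note ineqs = facts(1,3-5)[simplified]
  show ?thesis
    unfolding window_def unfolding mc by (simp; intro conjI; smt (z3) ineqs)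
qed

lemma window_5_1:
  assumes mc: "m = 5" "c = 1"
  shows "window 10"
proof -
  note facts = linear_facts[unfolded mc, simplified]
  note [simp] = facts(2,6-9) step_facts[of 10, unfolded mc, simplified]
  note ineqs = facts(1,3-5)[simplified]
  show ?thesis
    unfolding window_def unfolding mc by (simp; intro conjI; smt (z3) ineqs)
qed

lemma window_6_1:
  assumes mc: "m = 6" "c = 1"
  shows "window 11"
proof -
  note facts = linear_facts[unfolded mc, simplified]
  note [simp] = facts(2,6-9) step_facts[of 11, unfolded mc, simplified]
  note ineqs = facts(1,3-5)[simplified]
  show ?thesis
    unfolding window_def unfolding mc by (simp; intro conjI; smt (z3) ineqs)
qed

lemma window_7_1:
  assumes mc: "m = 7" "c = 1"
  shows "window 12"
proof -
  note facts = linear_facts[unfolded mc, simplified]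
  note [simp] = facts(2,6-9) step_facts[of 12, unfolded mc, simplified]
  note ineqs = facts(1,3-5)[simplified]
  show ?thesis
    unfolding window_def unfolding mc by (simp; intro conjI; smt (z3) ineqs)
qed

lemma window_8_1:
  assumes mc: "m = 8" "c = 1"
  shows "window 13"
proof -
  note facts = linear_facts[unfolded mc, simplified]
  note [simp] = facts(2,6-9) step_facts[of 13, unfolded mc, simplified]
  note ineqs = facts(1,3-5)[simplified]
  show ?thesis
    unfolding window_def unfolding mc by (simp; intro conjI; smt (z3) ineqs)
qed

text \<open>Windows start at \<open>m + 3 * c + 2\<close> except for \<open>(m, c)\<close> equal to
  (6, 2), (9, 3), (10, 3) and (13, 4). There they start later, and positivity of \<open>F\<close> in
  between is checked directly.\<close>

lemma window_6_2:
  assumes mc: "m = 6" "c = 2"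
  shows "window 20"
proof -
  note facts = linear_facts[unfolded mc, simplified]
  note [simp] = facts(2,6-9) step_facts[of 20, unfolded mc, simplified]
  note ineqs = facts(1,3-5)[simplified]
  show ?thesis
    unfolding window_def unfolding mc by (simp; intro conjI; smt (z3) ineqs)
qed

lemma window_7_2:
  assumes mc: "m = 7" "c = 2"
  shows "window 15"
proof -
  note facts = linear_facts[unfolded mc, simplified]
  note [simp] = facts(2,6-9) step_facts[of 15, unfolded mc, simplified]
  note ineqs = facts(1,3-5)[simplified]
  show ?thesis
    unfolding window_def unfolding mc by (simp; intro conjI; smt (z3) ineqs)
qed

lemma window_8_2:
  assumes mc: "m = 8" "c = 2"
  shows "window 16"
proof -
  note facts = linear_facts[unfolded mc, simplified]
  note [simp] = facts(2,6-9) step_facts[of 16, unfolded mc, simplified]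
  note ineqs = facts(1,3-5)[simplified]
  show ?thesis
    unfolding window_def unfolding mc by (simp; intro conjI; smt (z3) ineqs)
qed

lemma window_9_2:
  assumes mc: "m = 9" "c = 2"
  shows "window 17"
proof -
  note facts = linear_facts[unfolded mc, simplified]
  note [simp] = facts(2,6-9) step_facts[of 17, unfolded mc, simplified]
  note ineqs = facts(1,3-5)[simplified]
  show ?thesis
    unfolding window_def unfolding mc by (simp; intro conjI; smt (z3) ineqs)
qed

lemma window_10_2:
  assumes mc: "m = 10" "c = 2"
  shows "window 18"
proof -
  note facts = linear_facts[unfolded mc, simplified]
  note [simp] = facts(2,6-9) step_facts[of 18, unfolded mc, simplified]
  note ineqs = facts(1,3-5)[simplified]
  show ?thesis
    unfolding window_def unfolding mc by (simp; intro conjI; smt (z3) ineqs)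
qed

lemma window_11_2:
  assumes mc: "m = 11" "c = 2"
  shows "window 19"
proof -
  note facts = linear_facts[unfolded mc, simplified]
  note [simp] = facts(2,6-9) step_facts[of 19, unfolded mc, simplified]
  note ineqs = facts(1,3-5)[simplified]
  show ?thesis
    unfolding window_def unfolding mc by (simp; intro conjI; smt (z3) ineqs)
qed

lemma window_12_2:
  assumes mc: "m = 12" "c = 2"
  shows "window 20"
proof -
  note facts = linear_facts[unfolded mc, simplified]
  note [simp] = facts(2,6-9) step_facts[of 20, unfolded mc, simplified]
  note ineqs = facts(1,3-5)[simplified]
  show ?thesis
    unfolding window_def unfolding mc by (simp; intro conjI; smt (z3) ineqs)
qed

lemma window_7_3:
  assumes mc: "m = 7" "c = 3"
  shows "window 18"
proof -
  note facts = linear_facts[unfolded mc, simplified]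
  note [simp] = facts(2,6-9) step_facts[of 18, unfolded mc, simplified]
  note ineqs = facts(1,3-5)[simplified]
  show ?thesis
    unfolding window_def unfolding mc by (simp; intro conjI; smt (z3) ineqs)
qed

lemma window_8_3:
  assumes mc: "m = 8" "c = 3"
  shows "window 19"
proof -
  note facts = linear_facts[unfolded mc, simplified]
  note [simp] = facts(2,6-9) step_facts[of 19, unfolded mc, simplified]
  note ineqs = facts(1,3-5)[simplified]
  show ?thesis
    unfolding window_def unfolding mc by (simp; intro conjI; smt (z3) ineqs)
qed

lemma window_9_3:
  assumes mc: "m = 9" "c = 3"
  shows "window 33"
proof -
  note facts = linear_facts[unfolded mc, simplified]
  note [simp] = facts(2,6-9) step_facts[of 33, unfolded mc, simplified]
  note ineqs = facts(1,3-5)[simplified]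
  show ?thesis
    unfolding window_def unfolding mc by (simp; intro conjI; smt (z3) ineqs)
qed

lemma window_10_3:
  assumes mc: "m = 10" "c = 3"
  shows "window 29"
proof -
  note facts = linear_facts[unfolded mc, simplified]
  note [simp] = facts(2,6-9) step_facts[of 29, unfolded mc, simplified]
  note ineqs = facts(1,3-5)[simplified]
  show ?thesis
    unfolding window_def unfolding mc by (simp; intro conjI; smt (z3) ineqs)
qed

lemma window_11_3:
  assumes mc: "m = 11" "c = 3"
  shows "window 22"
proof -
  note facts = linear_facts[unfolded mc, simplified]
  note [simp] = facts(2,6-9) step_facts[of 22, unfolded mc, simplified]
  note ineqs = facts(1,3-5)[simplified]
  show ?thesis
    unfolding window_def unfolding mc by (simp; intro conjI; smt (z3) ineqs)
qed

lemma window_12_3: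
  assumes mc: "m = 12" "c = 3"
  shows "window 23"
proof -
  note facts = linear_facts[unfolded mc, simplified]
  note [simp] = facts(2,6-9) step_facts[of 23, unfolded mc, simplified]
  note ineqs = facts(1,3-5)[simplified]
  show ?thesis
    unfolding window_def unfolding mc by (simp; intro conjI; smt (z3) ineqs)
qed

lemma window_13_3:
  assumes mc: "m = 13" "c = 3"
  shows "window 24"
proof -
  note facts = linear_facts[unfolded mc, simplified]
  note [simp] = facts(2,6-9) step_facts[of 24, unfolded mc, simplified]
  note ineqs = facts(1,3-5)[simplified]
  show ?thesis
    unfolding window_def unfolding mc by (simp; intro conjI; smt (z3) ineqs)
qed

lemma window_14_3:
  assumes mc: "m = 14" "c = 3"
  shows "window 25"
proof -
  note facts = linear_facts[unfolded mc, simplified]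
  note [simp] = facts(2,6-9) step_facts[of 25, unfolded mc, simplified]
  note ineqs = facts(1,3-5)[simplified]
  show ?thesis
    unfolding window_def unfolding mc by (simp; intro conjI; smt (z3) ineqs)
qed

lemma window_15_3:
  assumes mc: "m = 15" "c = 3"
  shows "window 26"
proof -
  note facts = linear_facts[unfolded mc, simplified]
  note [simp] = facts(2,6-9) step_facts[of 26, unfolded mc, simplified]
  note ineqs = facts(1,3-5)[simplified]
  show ?thesis
    unfolding window_def unfolding mc by (simp; intro conjI; smt (z3) ineqs)
qed

lemma window_13_4:
  assumes mc: "m = 13" "c = 4"
  shows "window 44"
proof -
  note facts = linear_facts[unfolded mc, simplified]
  note [simp] = facts(2,6-9) step_facts[of 44, unfolded mc, simplified]
  note ineqs = facts(1,3-5)[simplified]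
  show ?thesis
    unfolding window_def unfolding mc by (simp; intro conjI; smt (z3) ineqs)
qed

lemma window_14_4:
  assumes mc: "m = 14" "c = 4"
  shows "window 28"
proof -
  note facts = linear_facts[unfolded mc, simplified]
  note [simp] = facts(2,6-9) step_facts[of 28, unfolded mc, simplified]
  note ineqs = facts(1,3-5)[simplified]
  show ?thesis
    unfolding window_def unfolding mc by (simp; intro conjI; smt (z3) ineqs)
qed

lemma window_15_4:
  assumes mc: "m = 15" "c = 4"
  shows "window 29"
proof -
  note facts = linear_facts[unfolded mc, simplified]
  note [simp] = facts(2,6-9) step_facts[of 29, unfolded mc, simplified]
  note ineqs = facts(1,3-5)[simplified]
  show ?thesis
    unfolding window_def unfolding mc by (simp; intro conjI; smt (z3) ineqs)
qed

lemma window_16_4: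
  assumes mc: "m = 16" "c = 4"
  shows "window 30"
proof -
  note facts = linear_facts[unfolded mc, simplified]
  note [simp] = facts(2,6-9) step_facts[of 30, unfolded mc, simplified]
  note ineqs = facts(1,3-5)[simplified]
  show ?thesis
    unfolding window_def unfolding mc by (simp; intro conjI; smt (z3) ineqs)
qed

lemma window_17_4:
  assumes mc: "m = 17" "c = 4"
  shows "window 31"
proof -
  note facts = linear_facts[unfolded mc, simplified]
  note [simp] = facts(2,6-9) step_facts[of 31, unfolded mc, simplified]
  note ineqs = facts(1,3-5)[simplified]
  show ?thesis
    unfolding window_def unfolding mc by (simp; intro conjI; smt (z3) ineqs)
qed

lemma window_18_4:
  assumes mc: "m = 18" "c = 4"
  shows "window 32"
proof -
  note facts = linear_facts[unfolded mc, simplified]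
  note [simp] = facts(2,6-9) step_facts[of 32, unfolded mc, simplified]
  note ineqs = facts(1,3-5)[simplified]
  show ?thesis
    unfolding window_def unfolding mc by (simp; intro conjI; smt (z3) ineqs)
qed

lemma window_17_5:
  assumes mc: "m = 17" "c = 5"
  shows "window 34"
proof -
  note facts = linear_facts[unfolded mc, simplified]
  note [simp] = facts(2,6-9) step_facts[of 34, unfolded mc, simplified]
  note ineqs = facts(1,3-5)[simplified]
  show ?thesis
    unfolding window_def unfolding mc by (simp; intro conjI; smt (z3) ineqs)
qed

lemma window_18_5:
  assumes mc: "m = 18" "c = 5"
  shows "window 35"
proof -
  note facts = linear_facts[unfolded mc, simplified]
  note [simp] = facts(2,6-9) step_facts[of 35, unfolded mc, simplified]
  note ineqs = facts(1,3-5)[simplified]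
  show ?thesis
    unfolding window_def unfolding mc by (simp; intro conjI; smt (z3) ineqs)
qed

lemma window_19_5:
  assumes mc: "m = 19" "c = 5"
  shows "window 36"
proof -
  note facts = linear_facts[unfolded mc, simplified]
  note [simp] = facts(2,6-9) step_facts[of 36, unfolded mc, simplified]
  note ineqs = facts(1,3-5)[simplified]
  show ?thesis
    unfolding window_def unfolding mc by (simp; intro conjI; smt (z3) ineqs)
qed

lemma window_20_5:
  assumes mc: "m = 20" "c = 5"
  shows "window 37"
proof -
  note facts = linear_facts[unfolded mc, simplified]
  note [simp] = facts(2,6-9) step_facts[of 37, unfolded mc, simplified]
  note ineqs = facts(1,3-5)[simplified]
  show ?thesis
    unfolding window_def unfolding mc by (simp; intro conjI; smt (z3) ineqs)
qed

lemma window_21_5: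
  assumes mc: "m = 21" "c = 5"
  shows "window 38"
proof -
  note facts = linear_facts[unfolded mc, simplified]
  note [simp] = facts(2,6-9) step_facts[of 38, unfolded mc, simplified]
  note ineqs = facts(1,3-5)[simplified]
  show ?thesis
    unfolding window_def unfolding mc by (simp; intro conjI; smt (z3) ineqs)
qed

lemma window_22_6:
  assumes mc: "m = 22" "c = 6"
  shows "window 42"
proof -
  note facts = linear_facts[unfolded mc, simplified]
  note [simp] = facts(2,6-9) step_facts[of 42, unfolded mc, simplified]
  note ineqs = facts(1,3-5)[simplified]
  show ?thesis
    unfolding window_def unfolding mc by (simp; intro conjI; smt (z3) ineqs)
qed

lemma window_23_6:
  assumes mc: "m = 23" "c = 6"
  shows "window 43"
proof -
  note facts = linear_facts[unfolded mc, simplified]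
  note [simp] = facts(2,6-9) step_facts[of 43, unfolded mc, simplified]
  note ineqs = facts(1,3-5)[simplified]
  show ?thesis
    unfolding window_def unfolding mc by (simp; intro conjI; smt (z3) ineqs)
qed

lemma window_24_6:
  assumes mc: "m = 24" "c = 6"
  shows "window 44"
proof -
  note facts = linear_facts[unfolded mc, simplified]
  note [simp] = facts(2,6-9) step_facts[of 44, unfolded mc, simplified]
  note ineqs = facts(1,3-5)[simplified]
  show ?thesis
    unfolding window_def unfolding mc by (simp; intro conjI; smt (z3) ineqs)
qed

lemma window_25_6:
  assumes mc: "m = 25" "c = 6"
  shows "window 45"
proof -
  note facts = linear_facts[unfolded mc, simplified]
  note [simp] = facts(2,6-9) step_facts[of 45, unfolded mc, simplified]
  note ineqs = facts(1,3-5)[simplified]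
  show ?thesis
    unfolding window_def unfolding mc by (simp; intro conjI; smt (z3) ineqs)
qed

end

text \<open>For the two excluded pairs the linear facts do not imply the claim; \<open>not_5_2\<close> and \<open>not_12_4\<close>
  rule them out by (ii) and by explicit representations of small numbers.\<close>

lemma F_pos:
  assumes "(m, c) \<noteq> (5, 2)" "(m, c) \<noteq> (12, 4)" "c < N"
  shows "0 < F N"
proof -
  have low: "3 * (int c * int c) + 13 * int c \<le> 8 * int m + 10" "2 * c + 1 \<le> m"
    using quadratic_bound m_ge by (simp_all add: power2_eq_square)
  note finite = F_pos_if_window_list[OF _ _ assms(3)]
  \<comment> \<open>For \<open>c \<le> 6\<close> the bounds \<open>low\<close> and the two
    exclusions give the least \<open>m\<close>; the first \<open>m\<close> left to
    \<open>F_pos_uniform\<close> is \<open>v + 2 * c + 2\<close> for the \<open>v\<close>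
    supplied.\<close>
  consider "c = 1" | "c = 2" | "c = 3" | "c = 4" | "c = 5" | "c = 6" | "c = 7" | "8 \<le> c"
    using c_pos by linarith
  then show ?thesis
  proof cases
    case 1
    then consider "m = 3" | "m = 4" | "m = 5" | "m = 6" | "m = 7" | "m = 8" | "9 \<le> m"
      using low assms(1,2) by force
    then show ?thesis
      by cases (use 1 assms(3) F_pos_3_1 finite[OF window_4_1] finite[OF window_5_1] finite[OF window_6_1]
        finite[OF window_7_1] finite[OF window_8_1] F_pos_uniform[of 5] in simp_all)
  next
    case 2
    then consider "m = 6" | "m = 7" | "m = 8" | "m = 9" | "m = 10" | "m = 11" | "m = 12" | "13 \<le> m"
      using low assms(1,2) by force
    then show ?thesis
      by cases (use 2 assms(3) finite[OF window_6_2] finite[OF window_7_2] finite[OF window_8_2]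
        finite[OF window_9_2] finite[OF window_10_2] finite[OF window_11_2]
        finite[OF window_12_2] F_pos_uniform[of 7] in simp_all)
  next
    case 3
    then consider "m = 7" | "m = 8" | "m = 9" | "m = 10" | "m = 11" | "m = 12" | "m = 13" | "m = 14" | "m = 15" | "16 \<le> m"
      using low assms(1,2) by force
    then show ?thesis
      by cases (use 3 assms(3) finite[OF window_7_3] finite[OF window_8_3] finite[OF window_9_3]
        finite[OF window_10_3] finite[OF window_11_3] finite[OF window_12_3]
        finite[OF window_13_3] finite[OF window_14_3] finite[OF window_15_3]
        F_pos_uniform[of 8] in simp_all)
  next
    case 4
    then consider "m = 13" | "m = 14" | "m = 15" | "m = 16" | "m = 17" | "m = 18" | "19 \<le> m"
      using low assms(1,2) by force
    then show ?thesis
      by cases (use 4 assms(3) finite[OF window_13_4] finite[OF window_14_4] finite[OF window_15_4]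
        finite[OF window_16_4] finite[OF window_17_4] finite[OF window_18_4]
        F_pos_uniform[of 9] in simp_all)
  next
    case 5
    then consider "m = 17" | "m = 18" | "m = 19" | "m = 20" | "m = 21" | "22 \<le> m"
      using low assms(1,2) by force
    then show ?thesis
      by cases (use 5 assms(3) finite[OF window_17_5] finite[OF window_18_5] finite[OF window_19_5]
        finite[OF window_20_5] finite[OF window_21_5] F_pos_uniform[of 10] in simp_all)
  next
    case 6
    then consider "m = 22" | "m = 23" | "m = 24" | "m = 25" | "26 \<le> m"
      using low assms(1,2) by force
    then show ?thesis
      by cases (use 6 assms(3) finite[OF window_22_6] finite[OF window_23_6] finite[OF window_24_6]
        finite[OF window_25_6] F_pos_uniform[of 12] in simp_all)
  next
    case 7
    \<comment> \<open>Here \<open>low\<close> already gives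
      \<open>m \<ge> 29 = 13 + 2 * c + 2\<close>.\<close>
    then show ?thesis using F_pos_uniform[of 13] low assms(3) by simp
  next
    case 8
    \<comment> \<open>Linearizes the quadratic bound to \<open>m \<ge> 4 * c + 4\<close>, which
      admits \<open>v = 2 * c + 2\<close>.\<close>
    have "8 * int c \<le> int c * int c" using 8 by (intro mult_right_mono) auto
    then have "2 * int c + 2 + 2 * int c + 2 \<le> int m" using low(1) 8 by linarith
    moreover have "2 * (int c)\<^sup>2 + 34 * int c + 12 + (int c + 3)\<^sup>2
        \<le> 2 * (int (2 * c + 2) * (int (2 * c + 2) + 3) + 2 * (int (2 * c + 2) - 1))"
    proof -
      have "2 * (int (2 * c + 2) * (int (2 * c + 2) + 3) + 2 * (int (2 * c + 2) - 1)) -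
          (2 * (int c)\<^sup>2 + 34 * int c + 12 + (int c + 3)\<^sup>2) = 5 * (int c * int c) - 4 * int c + 3"
        by (simp add: power2_eq_square algebra_simps)
      then show ?thesis using \<open>8 * int c \<le> int c * int c\<close> 8 by linarith
    qed
    ultimately show ?thesis
      using 8 assms(3) by (intro F_pos_uniform[of "2 * c + 2"]) auto
  qed
qed

end

section \<open>The recurrence\<close>

text \<open>Serves the case where 13 lies in \<open>S\<close>, in which \<open>lid_m3_le\<close>
  supplies the bound on \<open>b 15\<close>.\<close>

lemma (in lid_tail) not_12_4_if_b_15_le:
  assumes mc: "m = 12" "c = 4" and "b 15 \<le> 16"
  shows False
proof -
  note [simp] = upt_1_numeral b_Suc_0 stride_sum_rec and [simp del] = One_nat_def
  note facts = linear_facts[unfolded mc, simplified]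
  note [simp] = facts(2,6-9)
  note ineqs = facts(1,3-5)[simplified]
  show False using assms(3) by (smt (z3) ineqs)
qed

text \<open>A set for \<open>m + 4\<close> containing \<open>m + 2\<close> would need the remainder
  1, hence the index 1 at forbidden distance \<open>m + 1\<close>; without \<open>m + 2\<close> the
  sum is at most \<open>m + 2\<close>.\<close>

lemma lid_m3_le:
  assumes "0 \<notin> S" "0 < m" "\<And>s. 0 < s \<Longrightarrow> s < m \<Longrightarrow> s \<in> S" "m \<notin> S" "m + 1 \<in> S"
  shows "lid S (m + 3) \<le> m + 4"
proof (rule lid_le)
  show "\<not> representable S (m + 3) (m + 4)"
  proof
    assume "representable S (m + 3) (m + 4)"
    then obtain L where L: "L \<subseteq> {1..<m + 3}" "legal_index_set S L" "m + 4 = (\<Sum>l\<in>L. lid S l)"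
      by (auto simp: representable_def)
    have fin: "finite L" using L(1) finite_subset by blast
    show False
    proof (cases "m + 2 \<in> L")
      case True
      then have rest: "(\<Sum>l\<in>L - {m + 2}. lid S l) = 1"
        using L(3) sum.remove[OF fin True, of "lid S"] lid_first_gap[OF assms(1-4)] by simp
      then obtain l where l: "l \<in> L - {m + 2}" by (metis all_not_in_conv sum.empty zero_neq_one)
      then have "lid S l \<le> 1"
        unfolding rest[symmetric] using fin by (intro member_le_sum) auto
      moreover have "1 \<le> l" using l L(1) by auto
      ultimately have "l = 1" using lid_ge_index[OF assms(1), of l] by simp
      then show False using legal_diff[OF L(2), of 1 "m + 2"] l True assms(5) by simp
    next
      case False
      have "L \<subseteq> {1..m + 1}"
      proof
        fix l assume "l \<in> L"
        then have "1 \<le> l" "l < m + 3" "l \<noteq> m + 2" using L(1) False by auto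
        then show "l \<in> {1..m + 1}" by simp
      qed
      from legal_sum_le_stride_sum[OF assms(1-3) this L(2)]
      have "m + 4 \<le> stride_sum m (lid S) (m + 1)" using L(3) by simp
      moreover have "stride_sum m (lid S) (m + 1) = m + 2"
        using stride_sum_rec[OF assms(2), of "m + 1" "lid S"] stride_sum_short[OF assms(2), of 1 "lid S"]
          lid_initial[OF assms(1-3), of 1] lid_initial[OF assms(1-3), of "m + 1"] assms(2) by simp
      ultimately show False by simp
    qed
  qed
qed simp

fun extend_rec :: "nat \<Rightarrow> nat \<Rightarrow> (nat \<Rightarrow> int) \<Rightarrow> nat \<Rightarrow> int" where
  "extend_rec K k f n =
    (if n \<le> K then f n else extend_rec K k f (n - 1) + extend_rec K k f (n - 1 - k))"

declare extend_rec.simps [simp del]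

section \<open>Consequences of (ii) and (iii), with \<open>k\<close> written as
  \<open>m + c\<close>\<close>

locale lid_conditions =
  fixes S :: "nat set" and m c d :: nat
  assumes zero_notin: "0 \<notin> S" and m_pos: "0 < m" and c_pos: "0 < c" and d_pos: "0 < d"
    and below_m: "\<And>s. 0 < s \<Longrightarrow> s < m \<Longrightarrow> s \<in> S" and m_notin: "m \<notin> S"
    and k_in: "m + c \<in> S" and k_max: "\<And>s. s \<in> S \<Longrightarrow> s \<le> m + c"
    and cond_ii: "\<And>n. c + d + 1 \<le> n \<Longrightarrow> n \<le> m + 2 * c + d + 1 \<Longrightarrow>
      lid S (n + c) + lid S (n - d) < lid S (n + 1) + lid S n"
    and cond_iii: "\<And>n. m + 2 * c + 1 \<le> n \<Longrightarrow> n \<le> 2 * m + 3 * c + d + 2 \<Longrightarrow>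
      stride_sum m (lid S) (n - 1) < lid S n + lid S (n - (m + c))"
begin

abbreviation a :: "nat \<Rightarrow> nat" where "a \<equiv> lid S"

abbreviation T :: "nat \<Rightarrow> nat" where "T \<equiv> stride_sum m (lid S)"

lemma T_rec: "0 < x \<Longrightarrow> T x = a x + T (x - m)"
  by (rule stride_sum_rec[OF m_pos])

lemmas T_mono = stride_sum_lid_mono[OF zero_notin m_pos]
lemmas a_init = lid_initial[OF zero_notin m_pos below_m]
lemmas a_gap = lid_first_gap[OF zero_notin m_pos below_m m_notin]
lemmas a_ge = lid_ge_index[OF zero_notin]

lemma rec_init:
  "m + 2 * c + 1 \<le> n \<Longrightarrow> n \<le> 2 * m + 3 * c + d + 2 \<Longrightarrow> a (n + 1) = a n + a (n - (m + c))"
  using lid_Suc_eq[OF zero_notin m_pos below_m k_in k_max _ cond_iii[of n]] by simp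

text \<open>Condition (iii) at \<open>n = N + m + c + 1\<close>: the recurrence on the left and the
  first stride term on the right both contribute \<open>a (N + m + c)\<close>, which
  cancels.\<close>

lemma F_init:
  assumes "c < N" "N \<le> m + 2 * c + d + 1"
  shows "T (N + c) < a N + a (N + 1)"
proof -
  have "T (N + m + c) < a (N + m + c + 1) + a (N + 1)"
    using cond_iii[of "N + m + c + 1"] assms by simp
  moreover have "a (N + m + c + 1) = a (N + m + c) + a N"
    using rec_init[of "N + m + c"] assms by simp
  moreover have "T (N + m + c) = a (N + m + c) + T (N + c)"
    using T_rec[of "N + m + c"] assms by simp
  ultimately show ?thesis by simp
qed

text \<open>For smaller \<open>m\<close> the second stride term in \<open>T (2 * c + 1)\<close>, or
  in a nearby stride sum when \<open>m = 2 * c\<close>, already makes the inequality of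
  \<open>F_init\<close> fail.\<close>

lemma m_large: "2 * c + 1 \<le> m"
proof -
  have F1: "T (2 * c + 1) < a (c + 1) + a (c + 2)"
    using F_init[of "c + 1"] by (simp add: mult_2)
  have T1: "T (2 * c + 1) = a (2 * c + 1) + T (2 * c + 1 - m)" by (rule T_rec) simp
  have "c < m"
  proof (rule ccontr)
    assume "\<not> c < m"
    then have "c + 1 \<le> 2 * c + 1 - m" by linarith
    then have "a (c + 1) \<le> T (2 * c + 1 - m)"
      using T_rec[of "c + 1"] T_mono[of "c + 1" "2 * c + 1 - m"] by linarith
    moreover have "a (c + 2) \<le> a (2 * c + 1)"
      using c_pos by (intro lid_le_lid[OF zero_notin]) auto
    ultimately show False using F1 T1 by simp
  qed
  then have init: "a (c + 1) = c + 1" "a (c + 2) = c + 2"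
    using a_init[of "c + 1"] a_init[of "c + 2"] by auto
  have T2: "2 \<le> T 2" using T_rec[of 2] a_ge[of 2] by simp
  have "2 * c \<le> m"
  proof (rule ccontr)
    assume "\<not> 2 * c \<le> m"
    then have "T 2 \<le> T (2 * c + 1 - m)" by (intro T_mono) simp
    then show False using F1 T1 T2 init a_ge[of "2 * c + 1"] by simp
  qed
  moreover have "m \<noteq> 2 * c"
  proof
    assume m: "m = 2 * c"
    show False
    proof (cases "c = 1")
      case True
      then have m2: "m = 2" using m by simp
      \<comment> \<open>For \<open>m = 2\<close> the value \<open>a (c + 3) = a 4\<close> is not an
        initial one, so a later instance is used; \<open>N = 6\<close> is in range because
        \<open>d \<ge> 1\<close>.\<close>
      have "T 7 < a 6 + a 7" using F_init[of 6] True m2 d_pos by simp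
      moreover have "T 7 = a 7 + T 5" "T 5 = a 5 + T 3" "T 3 = a 3 + T 1" "T 1 = a 1"
        using T_rec[of 7] T_rec[of 5] T_rec[of 3] T_rec[of 1] m2 by auto
      moreover have "a 3 = 3" "a 1 = 1" "a 2 = 2"
        using a_init[of 3] a_init[of 1] a_init[of 2] m2 by auto
      moreover have "a 6 = a 5 + a 2" using rec_init[of 5] True m2 by simp
      ultimately show False by simp
    next
      case False
      have "T (2 * c + 2) < a (c + 2) + a (c + 3)"
        using F_init[of "c + 2"] d_pos by (simp add: mult_2 numeral_3_eq_3)
      moreover have "T (2 * c + 2) = a (m + 2) + T 2" using T_rec[of "2 * c + 2"] m by simp
      moreover have "a (c + 3) = c + 3" using a_init[of "c + 3"] False c_pos m by simp
      ultimately show False using a_gap T2 init m by simp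
    qed
  qed
  ultimately show ?thesis by simp
qed

text \<open>If \<open>d < c\<close>, condition (ii) at its first argument
  \<open>n = c + d + 1\<close> involves only initial values, apart from
  \<open>a (2 * c + d + 1) \<ge> 2 * c + d + 1\<close>, and fails.\<close>

lemma d_large: "c \<le> d"
proof (rule ccontr)
  assume "\<not> c \<le> d"
  then have "d < c" by simp
  have "a (c + d + 1 + c) + a (c + 1) < a (c + d + 1 + 1) + a (c + d + 1)"
    using cond_ii[of "c + d + 1"] m_large \<open>d < c\<close> by simp
  moreover have "a (c + 1) = c + 1" "a (c + d + 1 + 1) = c + d + 2" "a (c + d + 1) = c + d + 1"
    using a_init[of "c + 1"] a_init[of "c + d + 1 + 1"] a_init[of "c + d + 1"] m_large \<open>d < c\<close> by auto
  ultimately show False using a_ge[of "c + d + 1 + c"] \<open>d < c\<close> by simp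
qed

lemma not_5_2: "(m, c) \<noteq> (5, 2)"
proof
  assume "(m, c) = (5, 2)"
  then have mc: "m = 5" "c = 2" by auto
  have init: "a 3 = 3" "a 4 = 4" "a 5 = 5" "a 6 = 6" "a 7 = 8"
    using a_init[of 3] a_init[of 4] a_init[of 5] a_init[of 6] a_gap mc by auto
  have rec: "a 11 = a 10 + a 3" "a 12 = a 11 + a 4" "a 13 = a 12 + a 5" "a 14 = a 13 + a 6"
    "a 15 = a 14 + a 7"
    using rec_init[of 10] rec_init[of 11] rec_init[of 12] rec_init[of 13] rec_init[of 14] mc by auto
  show False
  proof (cases "3 \<le> d")
    case True
    \<comment> \<open>\<open>N = 13\<close> is within the range of \<open>F_init\<close> exactly
      when \<open>d \<ge> 3\<close>; by the recurrence the inequality becomes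
      \<open>13 < 12\<close>.\<close>
    have "T 15 < a 13 + a 14" using F_init[of 13] mc True by simp
    moreover have "T 15 = a 15 + (a 10 + a 5)"
      using T_rec[of 15] T_rec[of 10] T_rec[of 5] mc by simp
    ultimately show False using rec init by simp
  next
    case False
    then have d: "d = 2" using d_large mc by simp
    \<comment> \<open>These give \<open>a 8 \<le> 10\<close> and \<open>a 9 + 3 < a 10\<close>,
      whereas (ii) at 8 gives \<open>a 10 < a 9 + a 8 - 6\<close>.\<close>
    have "T 8 < a 6 + a 7" "T 14 < a 12 + a 13"
      using F_init[of 6] F_init[of 12] mc d by simp_all
    moreover have "T 8 = a 8 + a 3" "T 14 = a 14 + (a 9 + a 4)"
      using T_rec[of 8] T_rec[of 3] T_rec[of 14] T_rec[of 9] T_rec[of 4] mc by simp_all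
    moreover have "a 10 + a 6 < a 9 + a 8" using cond_ii[of 8] mc d by simp
    ultimately show False using rec init by simp
  qed
qed

definition b :: "nat \<Rightarrow> int" where
  "b = extend_rec (m + 2 * c + 1) (m + c) (\<lambda>i. int (a i))"

lemma b_base: "n \<le> m + 2 * c + 1 \<Longrightarrow> b n = int (a n)"
  by (simp add: b_def extend_rec.simps)

lemma b_step: "c < j \<Longrightarrow> b (j + m + c + 1) = b (j + m + c) + b j"
  unfolding b_def by (subst extend_rec.simps) simp

lemma b_eq_init: "n \<le> 2 * m + 3 * c + d + 3 \<Longrightarrow> b n = int (a n)"
proof (induction n rule: less_induct)
  case (less n)
  show ?case
  proof (cases "n \<le> m + 2 * c + 1")
    case False
    define j where "j = n - (m + c + 1)"
    have j: "n = j + m + c + 1" "c < j" using False by (auto simp: j_def)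
    have "a n = a (j + m + c) + a j" using rec_init[of "j + m + c"] j less.prems by simp
    then show ?thesis using b_step[OF j(2)] less.IH[of "j + m + c"] less.IH[of j] less.prems j by simp
  qed (simp add: b_base)
qed

sublocale lid_tail b m c
proof
  show "0 < c" "2 * c + 1 \<le> m" by (fact c_pos m_large)+
  show "b j = int j" if "1 \<le> j" "j \<le> m + 1" for j
    using that b_base[of j] a_init[of j] by simp
  show "b (m + 2) = int m + 3"
    using b_base[of "m + 2"] a_gap c_pos by simp
  show "b (j + m + c + 1) = b (j + m + c) + b j" if "c < j" for j
    using that by (rule b_step)
  show "b (m + s + 1) \<le> b (m + s) + int s + 1" if s: "1 \<le> s" "s \<le> 2 * c" for s
  proof -
    have "a (m + s + 1) \<le> T (m + s) + 1"
      using lid_Suc_le_stride_sum[OF zero_notin m_pos below_m, of "m + s"] by simp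
    moreover have "T (m + s) = a (m + s) + s"
      using T_rec[of "m + s"] T_rec[of s] a_init[of s] s m_large by simp
    ultimately show ?thesis using b_base[of "m + s + 1"] b_base[of "m + s"] s by simp
  qed
  show "b (m + s) + 1 \<le> b (m + s + 1)" if s: "1 \<le> s" "s \<le> 2 * c" for s
    using lid_less_Suc[OF zero_notin, of "m + s"] b_base[of "m + s + 1"] b_base[of "m + s"] s by simp
  show "b (m + c + i) + int i \<le> b (m + c + i + 1)" if i: "1 \<le> i" "i \<le> c" for i
  proof -
    have "a (m + c + i) + a i \<le> a (m + c + i + 1)"
      using lid_superadditive[OF zero_notin k_max, of "m + c + i"] i by simp
    then show ?thesis
      using b_base[of "m + c + i + 1"] b_base[of "m + c + i"] a_init[of i] i m_large by simp
  qed
  show "stride_sum m b (N + c) < b N + b (N + 1)" if N: "c < N" "N \<le> m + 3 * c + 1" for N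
  proof -
    have "stride_sum m b (N + c) = stride_sum m (\<lambda>i. int (a i)) (N + c)"
      using N m_large by (intro stride_sum_cong b_eq_init) simp
    then have "stride_sum m b (N + c) = int (T (N + c))" by (simp add: int_stride_sum)
    then show ?thesis
      \<comment> \<open>Since \<open>c \<le> d\<close>, the range of \<open>F_init\<close> reaches
        \<open>m + 3 * c + 1\<close>.\<close>
      using F_init[of N] b_eq_init[of N] b_eq_init[of "N + 1"] N d_large by simp
  qed
qed

text \<open>If 13 is in \<open>S\<close>, then \<open>a 15 \<le> 16\<close> contradicts the linear
  facts. Otherwise differences 12 and 13 are both legal, and pairs force \<open>a 15 = 18\<close>,
  \<open>a 16 = 19\<close> and \<open>a 17 \<ge> 23\<close>, against \<open>a 17 \<le> 22\<close>
  from (iii).\<close>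

lemma not_12_4: "(m, c) \<noteq> (12, 4)"
proof
  assume "(m, c) = (12, 4)"
  then have mc: "m = 12" "c = 4" by auto
  have init: "a 2 = 2" "a 3 = 3" "a 13 = 13" "a 14 = 15"
    using a_init[of 2] a_init[of 3] a_init[of 13] a_gap mc by auto
  have le: "a 15 \<le> 18" "a 16 \<le> 20" "a 17 \<le> 22"
  proof -
    show "a 15 \<le> 18" using b_m3_le b_base[of 15] mc by simp
    show "a 16 \<le> 20" using b_le_linear[of 4] b_base[of 16] mc by simp
    have "T 17 < a 13 + a 14" using F_init[of 13] mc by simp
    moreover have "T 17 = a 17 + a 5" using T_rec[of 17] T_rec[of 5] mc by simp
    moreover have "a 5 = 5" using a_init[of 5] mc by simp
    ultimately show "a 17 \<le> 22" using init by simp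
  qed
  show False
  proof (cases "13 \<in> S")
    case True
    then have "a 15 \<le> 16"
      using lid_m3_le[OF zero_notin m_pos below_m m_notin] mc by simp
    then show False using not_12_4_if_b_15_le b_base[of 15] mc by simp
  next
    case False
    have "12 \<notin> S" using m_notin mc by simp
    have pair: "representable S n (a i + a j)" if "1 \<le> i" "i < j" "j < n" "j - i = 12 \<or> j - i = 13" for i j n
      using representable_pair[OF zero_notin that(1-3)] that(4) False \<open>12 \<notin> S\<close> by auto
    have below: "representable S n v" if "v < a j" "j \<le> n" for v j n
      using representable_mono[OF representable_less_lid[OF that(1)] that(2)] .
    have "18 \<le> a 15"
    proof (rule le_lid)
      fix v :: nat assume "v < 18"
      then consider "v < a 14" | "v = a 14" | "v = a 1 + a 14" | "v = a 2 + a 14"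
        using init a_init[of 1] mc by fastforce
      then show "representable S 15 v"
        by cases (use below[of v 14 15] representable_single[OF zero_notin, of 14 15]
            pair[of 1 14 15] pair[of 2 14 15] in simp_all)
    qed
    then have a15: "a 15 = 18" using le by simp
    \<comment> \<open>The number 20 is \<open>a 2 + a 15\<close>, with index difference 13.\<close>
    have "a 16 \<noteq> 20"
      using lid_not_representable[of S 16] pair[of 2 15 16] init a15 by auto
    moreover have "a 15 < a 16" using lid_less_Suc[OF zero_notin, of 15] by simp
    ultimately have a16: "a 16 = 19" using le a15 by simp
    have "23 \<le> a 17"
    proof (rule le_lid)
      fix v :: nat assume "v < 23"
      then consider "v < a 16" | "v = a 16" | "v = a 2 + a 15" | "v = a 3 + a 15" | "v = a 3 + a 16"
        using init a15 a16 by fastforce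
      then show "representable S 17 v"
        by cases (use below[of v 16 17] representable_single[OF zero_notin, of 16 17]
            pair[of 2 15 17] pair[of 3 15 17] pair[of 3 16 17] in simp_all)
    qed
    then show False using le by simp
  qed
qed

lemma F_b_pos: "c < N \<Longrightarrow> stride_sum m b (N + c) < b N + b (N + 1)"
  using F_pos[OF not_5_2 not_12_4] by (simp add: F_def)

text \<open>Positivity of \<open>F\<close> at \<open>N = n - (m + c + 2)\<close> is the inequality
  \<open>lid_Suc_eq\<close> needs at \<open>n - 1\<close>. It involves only terms below
  \<open>n\<close>, so the induction hypothesis transfers it from \<open>b\<close> to
  \<open>a\<close>.\<close>

lemma b_eq: "b n = int (a n)"
proof (induction n rule: less_induct)
  case (less n)
  show ?case
  proof (cases "n \<le> 2 * m + 3 * c + d + 3")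
    case False
    define N where "N = n - (m + c + 2)"
    have N: "n = N + 1 + m + c + 1" "c < N" using False by (auto simp: N_def)
    have "stride_sum m b (N + m + c) < b (N + 1 + m + c) + b (N + 1)"
      using F_b_pos[OF N(2)] b_step[OF N(2)] stride_sum_rec[OF m_pos, of "N + m + c" b] N(2)
      by (simp add: add.commute add.left_commute)
    moreover have "stride_sum m b (N + m + c) = stride_sum m (\<lambda>i. int (a i)) (N + m + c)"
      using N(1) by (intro stride_sum_cong less.IH) simp
    then have "stride_sum m b (N + m + c) = int (T (N + m + c))" by (simp add: int_stride_sum)
    moreover have IH: "b (N + 1 + m + c) = int (a (N + 1 + m + c))" "b (N + 1) = int (a (N + 1))"
      using less.IH N(1) by auto
    ultimately have "T (N + m + c) < a (N + 1 + m + c) + a (N + 1)" by simp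
    then have "a n = a (N + 1 + m + c) + a (N + 1)"
      using lid_Suc_eq[OF zero_notin m_pos below_m k_in k_max, of "N + 1 + m + c"] N by simp
    then show ?thesis using b_step[of "N + 1"] N IH by simp
  qed (simp add: b_eq_init)
qed

lemma recurrence:
  assumes "m + 2 * c < n"
  shows "a (n + 1) = a n + a (n - (m + c))"
proof -
  define j where "j = n - (m + c)"
  have "n = j + m + c" "c < j" using assms by (auto simp: j_def)
  then show ?thesis using b_step[of j] by (simp add: b_eq)
qed

end

theorem theorem3p6:
  fixes S :: "nat set" and k c d :: nat
  assumes "finite S" and "S \<noteq> {}" and "\<forall>s\<in>S. s > 0"
    and "k = Max S"
    and "c > 0" and "k - c = (LEAST m. m > 0 \<and> m \<notin> S)"
    and "d > 0"
    and "int k \<ge> 2 * int d - 4 * int c + 2"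
    and "\<forall>n. c + d + 1 \<le> n \<and> n \<le> k + c + 1 + d \<longrightarrow>
           lid S (n + 1) + lid S n > lid S (n + c) + lid S (n - d)"
    and "\<forall>n. k + c + 1 \<le> n \<and> n \<le> 2 * k + c + d + 2 \<longrightarrow>
           lid S n + lid S (n - k) >
             (\<Sum>i | i * (k - c) < n - 1. lid S (n - 1 - i * (k - c)))"
  shows "\<forall>n. n > k + c \<longrightarrow> lid S (n + 1) = lid S n + lid S (n - k)"
proof -
  define m where "m = k - c"
  have k_max: "s \<le> k" if "s \<in> S" for s using assms(1,4) that by simp
  \<comment> \<open>Makes the \<open>LEAST\<close> well defined, so \<open>m\<close> is positive;
    hence the subtraction \<open>k - c\<close> is not truncated and
    \<open>k = m + c\<close>.\<close>
  have "Suc k \<notin> S" using k_max by fastforce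
  then have "0 < m \<and> m \<notin> S"
    unfolding m_def assms(6) by (intro LeastI_ex[of "\<lambda>m. 0 < m \<and> m \<notin> S"]) auto
  then have m: "0 < m" "m \<notin> S" "k = m + c" by (auto simp: m_def)
  have "lid_conditions S m c d"
  proof
    show "0 \<notin> S" using assms(3) by auto
    show "s \<in> S" if "0 < s" "s < m" for s
      using not_less_Least[of s "\<lambda>m. 0 < m \<and> m \<notin> S"] that unfolding m_def assms(6) by simp
    show "m + c \<in> S" using assms(1,2,4) m(3) by simp
    show "s \<le> m + c" if "s \<in> S" for s using k_max that m(3) by simp
    show "lid S (n + c) + lid S (n - d) < lid S (n + 1) + lid S n"
      if "c + d + 1 \<le> n" "n \<le> m + 2 * c + d + 1" for n
      using assms(9) that m(3) by simp
    show "stride_sum m (lid S) (n - 1) < lid S n + lid S (n - (m + c))"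
      if "m + 2 * c + 1 \<le> n" "n \<le> 2 * m + 3 * c + d + 2" for n
      using assms(10) that m(3) unfolding stride_sum_def by simp
  qed (use m assms(5,7) in auto)
  then interpret lid_conditions S m c d .
  show ?thesis using recurrence m(3) by simp
qed

end
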